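(* Let $\mathbb{K}$ be a field, $R=\mathbb{K}[x_1,\dots,x_n]$, $\mathbf{a}\in\mathbb{N}^n$, and let $I=I_{\lambda-\mu}$ be an $\mathbf{a}$-determined shifted stable ideal in $R$, generated in degree $2$. If the diagram $D=D_{\lambda-\mu}$ is compatible, then the cellular complex $\mathcal{F}_{X_I}$ provides a minimal free resolution of $R/\widehat{I}^{[\mathbf{a}]}$.
   Context: Diagrams. A shifted partition $\lambda-\mu=(\lambda_1,\dots,\lambda_h;\mu_1,\dots,\mu_h)$ satisfies $i-1\le\mu_i<\lambda_i$ for $1\le i\le h$. Its shifted quasi-Ferrers diagram is $D=D_{\lambda-\mu}=\{(i,j)\in\mathbb{Z}_+^2\mid1\le i\le h,\ \mu_i<j\le\lambda_i\}$. It is connected if for each $1\le i\le h-1$ the sets $\{j\mid\mu_i<j\le\lambda_i\}$ and $\{j\mid\mu_{i+1}<j\le\lambda_{i+1}\}$ meet. A shifted stable ideal is an ideal $I=I_{\lambda-\mu}=(x_ix_j\mid(i,j)\in D_{\lambda-\mu})$ with $D_{\lambda-\mu}$ connected (and all $\lambda_i\le n$). Points are drawn with $i$ the row index increasing southward and $j$ the column index increasing eastward. Linear order. Points of $D$ are ordered as follows. If $i_1<i_2$ then $(i_1,j_1)\prec(i_2,j_2)$. The first row is ordered by increasing $j$. For $2\le k\le h$, let $t_k=\min(\{j\mid\mu_{k-1}<j\le\lambda_{k-1}\}\cap\{j\mid\mu_k<j\le\lambda_k\})$; row $k$ is ordered $(k,t_k)\prec(k,t_k-1)\prec\cdots\prec(k,\mu_k+1)\prec(k,t_k+1)\prec\cdots\prec(k,\lambda_k)$.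 Let $c_1\prec\cdots\prec c_\nu$ be all points of $D$ and $f_1\prec\cdots\prec f_\nu$ the corresponding generators ($f_k=x_ix_j$ if $c_k=(i,j)$). Good moves. A minimal quasi-Borel move is $c\to c'$ with $c\ne c'$ in $D$ in the same row or the same column and no other point of $D$ on the segment from $c$ to $c'$. The move $c_k\to c_{k'}$ is good if $k'<k$. Compatibility. For each $k$ let $X_k=\{x_j\mid\text{there is }i\ne j\text{ with }f_{k'}=f_kx_i/x_j\in G(I)\text{ and }f_{k'}\prec f_k\}$, where $G(I)$ is the set of minimal monomial generators. The connected diagram $D$ is compatible if (a) all horizontal good moves point westward, and (b) for each $k$, there are two good moves starting from $c_k$ if and only if $|X_k|=2$. In a compatible diagram each point starts at most two good moves; if there are two, one is horizontal, $(i,j)\to(i,j-1)$, the other is vertical northward, $(i,j)\to(i',j)$ with $i'<i$, and then $(i',j-1)\in D$. Duals. $I$ is $\mathbf{a}$-determined if each $f\in G(I)$ divides $\mathbf{x}^{\mathbf{a}}=\prod_kx_k^{\mathbf{a}(k)}$; $\widehat{I}^{[\mathbf{a}]}$ is the monomial ideal with minimal generators $\widehat{f}=\mathbf{x}^{\mathbf{a}}/f$, $f\in G(I)$. The complex $X_I$ (for $D$ compatible). The empty face is the unique face of dimension $-1$. The $0$-cells are the points of $D$. The $1$-cells are the segments given by the good moves, oriented in the direction of the move (horizontal ones westward, vertical ones northward). The $2$-cells are the bounded rectangular regions cut out in the plane by the good moves; there is exactly one for each point $(i,j)$ starting two good moves $(i,j)\to(i,j-1)$ and $(i,j)\to(i',j)$,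 namely the rectangle with corners $(i,j),(i,j-1),(i',j),(i',j-1)$, having $(i,j)$ as lower right corner. Its boundary $1$-cells are the bottom edge $(i,j)\to(i,j-1)$, the right edge $(i,j)\to(i',j)$, the top edge $(i',j)\to(i',j-1)$, and all vertical good moves in column $j-1$ lying between $(i,j-1)$ and $(i',j-1)$. Each $2$-cell is oriented so that the induced boundary orientation is counterclockwise. Labels. The $0$-cell $(i,j)$ is labeled $\mathbf{x}^{\mathbf{a}}/(x_ix_j)$; the $1$-cell $(i,j)\to(i,j-1)$ is labeled $\mathbf{x}^{\mathbf{a}}/x_i$; the $1$-cell $(i,j)\to(i',j)$ is labeled $\mathbf{x}^{\mathbf{a}}/x_j$; each $2$-cell is labeled $\mathbf{x}^{\mathbf{a}}$; the empty face is labeled $1$. The complex $\mathcal{F}_{X_I}$. For a face $P$ with label $\mathbf{x}^{\boldsymbol\alpha_P}$ let $R(-\boldsymbol\alpha_P)$ be the free $\mathbb{N}^n$-graded module with one generator, also denoted $P$, in multidegree $\boldsymbol\alpha_P$. Then $\mathcal{F}_{X_I}$ is $$0\to\bigoplus_{\dim P=2}R(-\boldsymbol\alpha_P)\xrightarrow{\partial_2}\bigoplus_{\dim P=1}R(-\boldsymbol\alpha_P)\xrightarrow{\partial_1}\bigoplus_{\dim P=0}R(-\boldsymbol\alpha_P)\xrightarrow{\partial_0}R\to0,$$ with $\partial(P)=\sum_Q\varepsilon(Q,P)\mathbf{x}^{\boldsymbol\alpha_P-\boldsymbol\alpha_Q}Q$, the sum over faces $Q$ of $P$ of dimension $\dim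 P-1$. Here the signs are given by the orientations: $\varepsilon(\varnothing,P)=1$ for a vertex $P$; for a $1$-cell $c\to c'$, $\varepsilon$ is $+1$ on $c'$ and $-1$ on $c$; for a $2$-cell, $\varepsilon$ is $+1$ on its right and top edges and $-1$ on its bottom edge and on all the edges of its left side. The statement means that $\mathcal{F}_{X_I}$ (rightmost $R$ in homological degree $0$) is a minimal $\mathbb{N}^n$-graded free resolution of $R/\widehat{I}^{[\mathbf{a}]}$.
   Formalization: Minimality is claimed only when the dual ideal is proper; if D is a single point (1,j) and x^a = x_1x_j, the dual ideal is R and the complex 0→R→R→0 resolves R/R = 0 but is not minimal, so the claim fails exactly there. *)

theory Defs
  imports "HOL-Algebra.Module" "HOL-Algebra.QuotRing" "HOL-Library.Poly_Mapping"
begin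

section \<open>Polynomial rings, monomials and monomial ideals\<close>

text \<open>Exponent vectors and polynomials use variables indexed by all of \<^typ>\<open>nat\<close>;
  membership in \<open>K[x\<^sub>1,\<dots>,x\<^sub>n]\<close> is imposed by the carrier of \<open>poly_ring n\<close>.\<close>

type_synonym expo = "nat \<Rightarrow>\<^sub>0 nat"
type_synonym 'k mpoly = "expo \<Rightarrow>\<^sub>0 'k"

definition poly_ring :: "nat \<Rightarrow> 'k::field mpoly ring" where
  "poly_ring n = \<lparr>carrier = {p. \<forall>m \<in> Poly_Mapping.keys p. Poly_Mapping.keys m \<subseteq> {1..n}},
     mult = (*), one = 1, zero = 0, add = (+)\<rparr>"

abbreviation var_expo :: "nat \<Rightarrow> expo" where
  "var_expo i \<equiv> Poly_Mapping.single i 1"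

definition monomial :: "expo \<Rightarrow> 'k::field mpoly" where
  "monomial m = Poly_Mapping.single m 1"

definition expo_dvd :: "expo \<Rightarrow> expo \<Rightarrow> bool" where
  "expo_dvd m m' \<longleftrightarrow> (\<forall>i. Poly_Mapping.lookup m i \<le> Poly_Mapping.lookup m' i)"

text \<open>The exponents of the minimal monomial generators \<open>G(I)\<close> of a monomial ideal \<open>I\<close>.\<close>

definition min_gens :: "'k::field mpoly set \<Rightarrow> expo set" where
  "min_gens I = {m. monomial m \<in> I \<and> (\<forall>m'. monomial m' \<in> I \<and> expo_dvd m' m \<longrightarrow> m' = m)}"

definition determined :: "expo \<Rightarrow> 'k::field mpoly set \<Rightarrow> bool" where
  "determined a I \<longleftrightarrow> (\<forall>m \<in> min_gens I. expo_dvd m a)"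

definition dual_ideal :: "nat \<Rightarrow> expo \<Rightarrow> 'k::field mpoly set \<Rightarrow> 'k mpoly set" where
  "dual_ideal n a I = genideal (poly_ring n) {monomial (a - m) | m. m \<in> min_gens I}"

definition irrelevant_ideal :: "nat \<Rightarrow> 'k::field mpoly set" where
  "irrelevant_ideal n = genideal (poly_ring n) {monomial (var_expo i) | i. i \<in> {1..n}}"


section \<open>Multigraded modules and minimal free resolutions\<close>

text \<open>The library's module records inherit ring multiplication and unit fields;
  they play no role for modules and are left unspecified below.\<close>

record ('a, 'b) graded_module = "('a, 'b) module" +
  component :: "expo \<Rightarrow> 'b set"

text \<open>For finite \<open>B\<close>, the free module \<open>\<Oplus>\<^bsub>b \<in> B\<^esub> R(-deg b)\<close>: coordinate functions extended by
  \<open>0\<close> outside \<open>B\<close>, the basis element \<open>b\<close> sitting in multidegree \<open>deg b\<close>.\<close>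

definition free_module ::
    "nat \<Rightarrow> 'b set \<Rightarrow> ('b \<Rightarrow> expo) \<Rightarrow> ('k::field mpoly, 'b \<Rightarrow> 'k mpoly) graded_module" where
  "free_module n B deg =
    \<lparr>carrier = {v. (\<forall>b \<in> B. v b \<in> carrier (poly_ring n)) \<and> (\<forall>b. b \<notin> B \<longrightarrow> v b = 0)},
     mult = undefined, one = undefined,
     zero = (\<lambda>b. 0), add = (\<lambda>v w b. v b + w b), smult = (\<lambda>r v b. r * v b),
     component = (\<lambda>\<gamma>. {v. (\<forall>b \<in> B. v b \<in> carrier (poly_ring n) \<and>
                              (\<forall>m \<in> Poly_Mapping.keys (v b). m + deg b = \<gamma>)) \<and>
                           (\<forall>b. b \<notin> B \<longrightarrow> v b = 0)})\<rparr>"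

text \<open>\<open>R/J\<close> as a module, with the multigrading induced by that of \<open>R\<close> (\<open>J\<close> a monomial ideal).\<close>

definition quotient_module ::
    "nat \<Rightarrow> 'k::field mpoly set \<Rightarrow> ('k mpoly, 'k mpoly set) graded_module" where
  "quotient_module n J =
    \<lparr>carrier = carrier (poly_ring n Quot J),
     mult = undefined, one = undefined,
     zero = zero (poly_ring n Quot J), add = add (poly_ring n Quot J),
     smult = (\<lambda>r X. mult (poly_ring n Quot J) (J +>\<^bsub>poly_ring n\<^esub> r) X),
     component = (\<lambda>\<gamma>. {J +>\<^bsub>poly_ring n\<^esub> p | p.
                          p \<in> carrier (poly_ring n) \<and> Poly_Mapping.keys p \<subseteq> {\<gamma>}})\<rparr>"

text \<open>Homogeneous \<open>R\<close>-linear maps of degree \<open>0\<close>.\<close>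

definition graded_hom ::
    "nat \<Rightarrow> ('k::field mpoly, 'b) graded_module \<Rightarrow> ('k mpoly, 'c) graded_module \<Rightarrow>
      ('b \<Rightarrow> 'c) \<Rightarrow> bool" where
  "graded_hom n M N f \<longleftrightarrow>
     f \<in> carrier M \<rightarrow> carrier N \<and>
     (\<forall>v \<in> carrier M. \<forall>w \<in> carrier M. f (v \<oplus>\<^bsub>M\<^esub> w) = f v \<oplus>\<^bsub>N\<^esub> f w) \<and>
     (\<forall>r \<in> carrier (poly_ring n). \<forall>v \<in> carrier M. f (r \<odot>\<^bsub>M\<^esub> v) = r \<odot>\<^bsub>N\<^esub> f v) \<and>
     (\<forall>\<gamma>. f ` component M \<gamma> \<subseteq> component N \<gamma>)"

text \<open>The complex \<open>\<cdots> \<rightarrow> F\<^sub>2 \<rightarrow> F\<^sub>1 \<rightarrow> F\<^sub>0 \<rightarrow> M \<rightarrow> 0\<close>, where \<open>F\<^sub>i\<close> is free on \<open>B i\<close> with degrees \<open>deg\<close>,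
  \<open>d i : F\<^bsub>i+1\<^esub> \<rightarrow> F\<^sub>i\<close> and the augmentation is \<open>\<eta> : F\<^sub>0 \<rightarrow> M\<close>, is an exact complex of
  multigraded modules.\<close>

definition graded_free_resolution ::
    "nat \<Rightarrow> (nat \<Rightarrow> 'b set) \<Rightarrow> ('b \<Rightarrow> expo) \<Rightarrow>
      (nat \<Rightarrow> ('b \<Rightarrow> 'k::field mpoly) \<Rightarrow> ('b \<Rightarrow> 'k mpoly)) \<Rightarrow>
      (('b \<Rightarrow> 'k mpoly) \<Rightarrow> 'c) \<Rightarrow> ('k mpoly, 'c) graded_module \<Rightarrow> bool" where
  "graded_free_resolution n B deg d \<eta> M \<longleftrightarrow>
     (let F = (\<lambda>i. free_module n (B i) deg) in
      (\<forall>i. finite (B i)) \<and>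
      graded_hom n (F 0) M \<eta> \<and>
      (\<forall>i. graded_hom n (F (Suc i)) (F i) (d i)) \<and>
      \<eta> ` carrier (F 0) = carrier M \<and>
      d 0 ` carrier (F 1) = a_kernel (F 0) M \<eta> \<and>
      (\<forall>i. d (Suc i) ` carrier (F (Suc (Suc i))) = a_kernel (F (Suc i)) (F i) (d i)))"

text \<open>Minimality: the image of \<open>F\<^bsub>i+1\<^esub>\<close> lies in \<open>(x\<^sub>1,\<dots>,x\<^sub>n) F\<^sub>i\<close>.\<close>

definition minimal_complex ::
    "nat \<Rightarrow> (nat \<Rightarrow> 'b set) \<Rightarrow> ('b \<Rightarrow> expo) \<Rightarrow>
      (nat \<Rightarrow> ('b \<Rightarrow> 'k::field mpoly) \<Rightarrow> ('b \<Rightarrow> 'k mpoly)) \<Rightarrow> bool" where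
  "minimal_complex n B deg d \<longleftrightarrow>
     (\<forall>i. \<forall>v \<in> carrier (free_module n (B (Suc i)) deg). \<forall>b \<in> B i.
        d i v b \<in> irrelevant_ideal n)"


section \<open>Diagrams\<close>

type_synonym point = "nat \<times> nat"

definition shifted_partition :: "nat \<Rightarrow> (nat \<Rightarrow> nat) \<Rightarrow> (nat \<Rightarrow> nat) \<Rightarrow> bool" where
  "shifted_partition h lam mu \<longleftrightarrow> (\<forall>i \<in> {1..h}. i - 1 \<le> mu i \<and> mu i < lam i)"

definition diagram :: "nat \<Rightarrow> (nat \<Rightarrow> nat) \<Rightarrow> (nat \<Rightarrow> nat) \<Rightarrow> point set" where
  "diagram h lam mu = {(i, j). 1 \<le> i \<and> i \<le> h \<and> mu i < j \<and> j \<le> lam i}"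

definition connected_diagram :: "nat \<Rightarrow> (nat \<Rightarrow> nat) \<Rightarrow> (nat \<Rightarrow> nat) \<Rightarrow> bool" where
  "connected_diagram h lam mu \<longleftrightarrow>
     (\<forall>i. 1 \<le> i \<and> i < h \<longrightarrow> {mu i<..lam i} \<inter> {mu (i + 1)<..lam (i + 1)} \<noteq> {})"

definition gen_expo :: "point \<Rightarrow> expo" where
  "gen_expo c = var_expo (fst c) + var_expo (snd c)"

definition diagram_ideal ::
    "nat \<Rightarrow> nat \<Rightarrow> (nat \<Rightarrow> nat) \<Rightarrow> (nat \<Rightarrow> nat) \<Rightarrow> 'k::field mpoly set" where
  "diagram_ideal n h lam mu =
     genideal (poly_ring n) {monomial (gen_expo c) | c. c \<in> diagram h lam mu}"

text \<open>Row \<open>k \<ge> 2\<close> is ordered \<open>t, t - 1, \<dots>, mu k + 1, t + 1, \<dots>, lam k\<close> with \<open>t = row_start lam mu k\<close>;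
  the relation below restricts to this order on the points of the diagram.\<close>

definition row_start :: "(nat \<Rightarrow> nat) \<Rightarrow> (nat \<Rightarrow> nat) \<Rightarrow> nat \<Rightarrow> nat" where
  "row_start lam mu k = Min ({mu (k - 1)<..lam (k - 1)} \<inter> {mu k<..lam k})"

definition row_prec :: "(nat \<Rightarrow> nat) \<Rightarrow> (nat \<Rightarrow> nat) \<Rightarrow> nat \<Rightarrow> nat \<Rightarrow> nat \<Rightarrow> bool" where
  "row_prec lam mu k j j' \<longleftrightarrow>
     (if k = 1 then j < j'
      else if j' \<le> row_start lam mu k then j' < j \<and> j \<le> row_start lam mu k
      else j < j')"

definition prec :: "(nat \<Rightarrow> nat) \<Rightarrow> (nat \<Rightarrow> nat) \<Rightarrow> point \<Rightarrow> point \<Rightarrow> bool" where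
  "prec lam mu c c' \<longleftrightarrow>
     fst c < fst c' \<or> (fst c = fst c' \<and> row_prec lam mu (fst c) (snd c) (snd c'))"

text \<open>For two points in a common row or column, the box they span is the segment joining them.\<close>

definition box :: "point \<Rightarrow> point \<Rightarrow> point set" where
  "box c c' = {min (fst c) (fst c')..max (fst c) (fst c')} \<times>
              {min (snd c) (snd c')..max (snd c) (snd c')}"

definition minimal_move :: "point set \<Rightarrow> point \<Rightarrow> point \<Rightarrow> bool" where
  "minimal_move D c c' \<longleftrightarrow>
     c \<in> D \<and> c' \<in> D \<and> c \<noteq> c' \<and> (fst c = fst c' \<or> snd c = snd c') \<and> D \<inter> box c c' = {c, c'}"

definition good_move ::
    "nat \<Rightarrow> (nat \<Rightarrow> nat) \<Rightarrow> (nat \<Rightarrow> nat) \<Rightarrow> point \<Rightarrow> point \<Rightarrow> bool" where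
  "good_move h lam mu c c' \<longleftrightarrow> minimal_move (diagram h lam mu) c c' \<and> prec lam mu c' c"

text \<open>The indices \<open>j\<close> of the variables \<open>x\<^sub>j\<close> in the set \<open>X\<^sub>k\<close> attached to the point \<open>c = c\<^sub>k\<close>.
  The generators of the ideal are distinct and all of degree \<open>2\<close>, so
  \<open>G(I)\<close> consists of the monomials of the points of the diagram; the equation is
  \<open>f\<^bsub>k'\<^esub> = f\<^sub>k x\<^sub>i / x\<^sub>j\<close> with the denominator cleared.\<close>

definition X_set :: "nat \<Rightarrow> (nat \<Rightarrow> nat) \<Rightarrow> (nat \<Rightarrow> nat) \<Rightarrow> point \<Rightarrow> nat set" where
  "X_set h lam mu c =
     {j. \<exists>i. \<exists>c' \<in> diagram h lam mu. i \<noteq> j \<and> prec lam mu c' c \<and>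
           gen_expo c' + var_expo j = gen_expo c + var_expo i}"

definition compatible :: "nat \<Rightarrow> (nat \<Rightarrow> nat) \<Rightarrow> (nat \<Rightarrow> nat) \<Rightarrow> bool" where
  "compatible h lam mu \<longleftrightarrow>
     (\<forall>c c'. good_move h lam mu c c' \<and> fst c = fst c' \<longrightarrow> snd c' < snd c) \<and>
     (\<forall>c \<in> diagram h lam mu.
        card {c'. good_move h lam mu c c'} = 2 \<longleftrightarrow> card (X_set h lam mu c) = 2)"


section \<open>The cell complex and its cellular complex\<close>

text \<open>\<open>Edge c c'\<close> is the segment oriented from \<open>c\<close> to \<open>c'\<close>; \<open>Rect i j i'\<close> is the rectangle with lower
  right corner \<open>(i, j)\<close> and upper left corner \<open>(i', j - 1)\<close>.\<close>

datatype face = EmptyFace | Vertex point | Edge point point | Rect nat nat nat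

fun face_dim :: "face \<Rightarrow> int" where
  "face_dim EmptyFace = -1"
| "face_dim (Vertex c) = 0"
| "face_dim (Edge c c') = 1"
| "face_dim (Rect i j i') = 2"

definition cell_complex :: "nat \<Rightarrow> (nat \<Rightarrow> nat) \<Rightarrow> (nat \<Rightarrow> nat) \<Rightarrow> face set" where
  "cell_complex h lam mu =
     {EmptyFace} \<union>
     {Vertex c | c. c \<in> diagram h lam mu} \<union>
     {Edge c c' | c c'. good_move h lam mu c c'} \<union>
     {Rect i j i' | i j i'. good_move h lam mu (i, j) (i, j - 1) \<and>
                            good_move h lam mu (i, j) (i', j) \<and> i' < i}"

fun label :: "expo \<Rightarrow> face \<Rightarrow> expo" where
  "label a EmptyFace = 0"
| "label a (Vertex c) = a - gen_expo c"
| "label a (Edge c c') =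
     (if fst c = fst c' then a - var_expo (fst c) else a - var_expo (snd c))"
| "label a (Rect i j i') = a"

text \<open>\<open>incidence Q P\<close> is \<open>\<epsilon>(Q,P)\<close>, set to \<open>0\<close> when \<open>Q\<close> is not a facet of \<open>P\<close>. For a rectangle the value
  \<open>1\<close> is taken on the right and top edges, and \<open>-1\<close> on the bottom edge and on the
  vertical good moves that make up the left side.\<close>

fun incidence :: "face \<Rightarrow> face \<Rightarrow> int" where
  "incidence EmptyFace (Vertex c) = 1"
| "incidence (Vertex q) (Edge c c') = (if q = c' then 1 else if q = c then -1 else 0)"
| "incidence (Edge c c') (Rect i j i') =
     (if (c = (i, j) \<and> c' = (i', j)) \<or> (c = (i', j) \<and> c' = (i', j - 1)) then 1
      else if (c = (i, j) \<and> c' = (i, j - 1)) \<or>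
              (snd c = j - 1 \<and> snd c' = j - 1 \<and> i' \<le> fst c' \<and> fst c' < fst c \<and> fst c \<le> i)
      then -1 else 0)"
| "incidence _ _ = 0"

text \<open>The basis in homological degree \<open>i\<close> consists of the faces of dimension \<open>i - 1\<close>.\<close>

definition cells :: "nat \<Rightarrow> (nat \<Rightarrow> nat) \<Rightarrow> (nat \<Rightarrow> nat) \<Rightarrow> nat \<Rightarrow> face set" where
  "cells h lam mu i = {P \<in> cell_complex h lam mu. face_dim P = int i - 1}"

text \<open>The map \<open>\<partial>\<^sub>i\<close> from homological degree \<open>i + 1\<close> to \<open>i\<close>: the \<open>R\<close>-linear extension of
  \<open>P \<mapsto> \<Sum>\<^sub>Q \<epsilon>(Q,P) x\<^bsup>\<alpha>\<^sub>P - \<alpha>\<^sub>Q\<^esup> Q\<close>.\<close>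

definition cellular_map ::
    "nat \<Rightarrow> (nat \<Rightarrow> nat) \<Rightarrow> (nat \<Rightarrow> nat) \<Rightarrow> expo \<Rightarrow> nat \<Rightarrow>
      (face \<Rightarrow> 'k::field mpoly) \<Rightarrow> (face \<Rightarrow> 'k mpoly)" where
  "cellular_map h lam mu a i v =
     (\<lambda>Q. if Q \<in> cells h lam mu i
          then \<Sum>P \<in> cells h lam mu (Suc i).
                 v P * (of_int (incidence Q P) * monomial (label a P - label a Q))
          else 0)"

text \<open>The projection \<open>R \<rightarrow> R/J\<close>, where \<open>R\<close> is the free module on the empty face.\<close>

definition augmentation ::
    "nat \<Rightarrow> 'k::field mpoly set \<Rightarrow> (face \<Rightarrow> 'k mpoly) \<Rightarrow> 'k mpoly set" where
  "augmentation n J v = J +>\<^bsub>poly_ring n\<^esub> v EmptyFace"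

end

theory Submission
  imports Defs
begin

text \<open>Compatibility forces \<open>mu\<close> to be weakly increasing, so that \<open>\<prec>\<close> is the lexicographic order on the
  diagram, and forces \<open>(i, i)\<close> to be a point whenever \<open>i\<close> indexes both a row and a point \<open>(p, i)\<close> with \<open>p < i\<close>.
  Consequently the dual ideal has linear quotients with respect to \<open>\<prec>\<close>: the colon ideal at a point
  is generated by the variables that label its horizontal and vertical good moves.
  A cycle is therefore reduced to zero by eliminating its coefficients on the cells attached to the
  \<open>\<prec>\<close>-last point. On vertices this uses the linear quotients; on edges, the two coefficients at the
  point form a Koszul syzygy, which is filled by the rectangle at that point; a rectangle is the only
  remaining one that contains its right edge.\<close>

section \<open>Polynomials and monomial ideals\<close>

text \<open>Exactness is shown by explicit elimination rather than by acyclicity of subcomplexes,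
  because each step then involves only the cells at one point. Two obstacles shape the work.
  Columns, unlike rows, can have gaps, since \<open>lam\<close> need not be monotone; the left side
  of a rectangle can thus consist of several vertical moves, and the square of the differential
  vanishes by a telescoping sum. Subtraction of exponents is truncated, so a quotient of labels can
  be used only after their divisibility is known.\<close>

lemmas lookup_expo = lookup_add lookup_minus lookup_single when_def

lemma poly_ring_sel [simp]:
  "mult (poly_ring n) = (*)" "one (poly_ring n) = 1"
  "zero (poly_ring n) = 0" "add (poly_ring n) = (+)"
  by (simp_all add: poly_ring_def)

lemma poly_carrier_iff:
  "p \<in> carrier (poly_ring n) \<longleftrightarrow> (\<forall>m \<in> Poly_Mapping.keys p. Poly_Mapping.keys m \<subseteq> {1..n})"
  by (simp add: poly_ring_def)

lemma poly_zero_closed [simp]: "0 \<in> carrier (poly_ring n)"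
  by (simp add: poly_carrier_iff)

lemma poly_one_closed [simp]: "1 \<in> carrier (poly_ring n)"
  by (simp add: poly_carrier_iff)

lemma poly_add_closed [simp]:
  "p \<in> carrier (poly_ring n) \<Longrightarrow> q \<in> carrier (poly_ring n) \<Longrightarrow> p + q \<in> carrier (poly_ring n)"
  using keys_add[of p q] by (fastforce simp: poly_carrier_iff)

lemma poly_uminus_closed [simp]:
  "p \<in> carrier (poly_ring n) \<Longrightarrow> - p \<in> carrier (poly_ring n)"
  by (simp add: poly_carrier_iff in_keys_iff)

lemma poly_minus_closed [simp]:
  "p \<in> carrier (poly_ring n) \<Longrightarrow> q \<in> carrier (poly_ring n) \<Longrightarrow> p - q \<in> carrier (poly_ring n)"
  using poly_add_closed[of p n "- q"] by simp

lemma poly_mult_closed [simp]: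
  assumes "p \<in> carrier (poly_ring n)" "q \<in> carrier (poly_ring n)"
  shows "p * q \<in> carrier (poly_ring n)"
  unfolding poly_carrier_iff
proof
  fix m assume "m \<in> Poly_Mapping.keys (p * q)"
  then obtain r s where "m = r + s" "r \<in> Poly_Mapping.keys p" "s \<in> Poly_Mapping.keys q"
    using keys_mult[of p q] by blast
  then show "Poly_Mapping.keys m \<subseteq> {1..n}"
    using assms keys_add[of r s] unfolding poly_carrier_iff by fastforce
qed

lemma poly_sum_closed [simp]:
  "(\<And>c. c \<in> C \<Longrightarrow> f c \<in> carrier (poly_ring n)) \<Longrightarrow> (\<Sum>c\<in>C. f c) \<in> carrier (poly_ring n)"
  by (induction C rule: infinite_finite_induct) auto

lemma poly_of_nat_closed [simp]: "of_nat z \<in> carrier (poly_ring n)"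
  by (induction z) auto

lemma poly_of_int_closed [simp]: "of_int z \<in> carrier (poly_ring n)"
  by (cases z) auto

lemma keys_monomial [simp]: "Poly_Mapping.keys (monomial m :: 'k::field mpoly) = {m}"
  by (simp add: monomial_def)

lemma poly_monomial_closed [simp]:
  "monomial m \<in> carrier (poly_ring n) \<longleftrightarrow> Poly_Mapping.keys m \<subseteq> {1..n}"
  by (simp add: poly_carrier_iff)

lemma monomial_mult: "monomial m * monomial m' = monomial (m + m')"
  by (simp add: monomial_def mult_single)

lemma monomial_zero [simp]: "monomial 0 = 1"
  by (simp add: monomial_def)

lemma monomial_nonzero [simp]: "monomial m \<noteq> 0"
  by (metis keys_monomial keys_zero insert_not_empty)

lemma keys_mult_of_int:
  "Poly_Mapping.keys (p * (of_int z * monomial e) :: 'k::field mpoly)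
     \<subseteq> (\<lambda>m. m + e) ` Poly_Mapping.keys p"
proof -
  have "of_int z * monomial e = Poly_Mapping.single e (of_int z :: 'k)"
    by (simp add: monomial_def mult_single flip: single_of_int)
  then show ?thesis
    using keys_mult[of p "of_int z * monomial e"] by (auto split: if_splits)
qed

lemma poly_mapping_sum_single:
  "p = (\<Sum>m\<in>Poly_Mapping.keys p. Poly_Mapping.single m (Poly_Mapping.lookup p m))"
  by (rule poly_mapping_eqI)
    (auto simp: lookup_sum lookup_single when_def in_keys_iff)

lemma expo_dvd_diff_add: "expo_dvd e m \<Longrightarrow> m - e + e = m"
  by (rule poly_mapping_eqI) (simp add: expo_dvd_def lookup_expo)

lemma keys_expo_diff: "Poly_Mapping.keys (m - e :: expo) \<subseteq> Poly_Mapping.keys m"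
  by (auto simp: in_keys_iff lookup_minus)

lemma lookup_mult_monomial:
  "Poly_Mapping.lookup (p * monomial e :: 'k::field mpoly) (m + e) = Poly_Mapping.lookup p m"
proof -
  have "p * monomial e = (\<Sum>l\<in>Poly_Mapping.keys p. Poly_Mapping.single (l + e) (Poly_Mapping.lookup p l))"
    by (subst poly_mapping_sum_single[of p])
      (simp add: sum_distrib_right monomial_def mult_single)
  then show ?thesis
    by (auto simp: lookup_sum lookup_single when_def in_keys_iff)
qed

lemma poly_part_divisible:
  fixes p :: "'k::field mpoly"
  assumes "p \<in> carrier (poly_ring n)" "A \<subseteq> Poly_Mapping.keys p" "\<And>m. m \<in> A \<Longrightarrow> expo_dvd e m"
  shows "\<exists>u \<in> carrier (poly_ring n).
           (\<Sum>m\<in>A. Poly_Mapping.single m (Poly_Mapping.lookup p m)) = u * monomial e \<and> (A = {} \<longrightarrow> u = 0)"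
proof (intro bexI conjI)
  let ?u = "\<Sum>m\<in>A. Poly_Mapping.single (m - e) (Poly_Mapping.lookup p m)"
  show "(\<Sum>m\<in>A. Poly_Mapping.single m (Poly_Mapping.lookup p m)) = ?u * monomial e"
    by (simp add: sum_distrib_right monomial_def mult_single expo_dvd_diff_add assms(3))
  show "?u \<in> carrier (poly_ring n)"
    using assms keys_expo_diff by (intro poly_sum_closed) (fastforce simp: poly_carrier_iff)
qed simp

text \<open>Explicit membership in the ideal generated by \<open>monomial e\<close> (if
  \<open>A\<close>) and \<open>monomial e'\<close> (if \<open>B\<close>). \<open>A\<close> and
  \<open>B\<close> will say whether a westward and a northward good move exist; terms that fit both
  go to the first part.\<close>

lemma poly_split_divisible:
  fixes p :: "'k::field mpoly"
  assumes "p \<in> carrier (poly_ring n)"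
    and "\<And>m. m \<in> Poly_Mapping.keys p \<Longrightarrow> A \<and> expo_dvd e m \<or> B \<and> expo_dvd e' m"
  obtains u w where "u \<in> carrier (poly_ring n)" "w \<in> carrier (poly_ring n)"
    "p = u * monomial e + w * monomial e'" "\<not> A \<Longrightarrow> u = 0" "\<not> B \<Longrightarrow> w = 0"
proof -
  define S where "S = {m \<in> Poly_Mapping.keys p. A \<and> expo_dvd e m}"
  define T where "T = Poly_Mapping.keys p - S"
  have S: "S \<subseteq> Poly_Mapping.keys p" "\<And>m. m \<in> S \<Longrightarrow> expo_dvd e m" "\<not> A \<Longrightarrow> S = {}"
    by (auto simp: S_def)
  have T: "T \<subseteq> Poly_Mapping.keys p" "\<And>m. m \<in> T \<Longrightarrow> expo_dvd e' m" "\<not> B \<Longrightarrow> T = {}"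
    using assms(2) by (auto simp: S_def T_def)
  have "p = (\<Sum>m\<in>S. Poly_Mapping.single m (Poly_Mapping.lookup p m))
          + (\<Sum>m\<in>T. Poly_Mapping.single m (Poly_Mapping.lookup p m))"
    unfolding T_def using S(1)
    by (subst poly_mapping_sum_single) (simp add: sum.subset_diff add.commute)
  moreover obtain u where "u \<in> carrier (poly_ring n)" "S = {} \<longrightarrow> u = 0"
    "(\<Sum>m\<in>S. Poly_Mapping.single m (Poly_Mapping.lookup p m)) = u * monomial e"
    using poly_part_divisible[OF assms(1) S(1,2)] by blast
  moreover obtain w where "w \<in> carrier (poly_ring n)" "T = {} \<longrightarrow> w = 0"
    "(\<Sum>m\<in>T. Poly_Mapping.single m (Poly_Mapping.lookup p m)) = w * monomial e'"
    using poly_part_divisible[OF assms(1) T(1,2)] by blast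
  ultimately show thesis
    using S(3) T(3) that by auto
qed

lemma poly_divisible:
  fixes p :: "'k::field mpoly"
  assumes "p \<in> carrier (poly_ring n)" "\<And>m. m \<in> Poly_Mapping.keys p \<Longrightarrow> expo_dvd e m"
  obtains u where "u \<in> carrier (poly_ring n)" "p = u * monomial e"
  using poly_part_divisible[OF assms(1) order.refl assms(2)] that
  by (auto simp flip: poly_mapping_sum_single)

text \<open>The Koszul relation of two distinct variables. The sign is put on \<open>p\<close> to
  match the incidence -1 of the bottom edge and 1 of the right edge of a rectangle.\<close>

lemma variable_syzygy:
  fixes p q :: "'k::field mpoly"
  assumes "p \<in> carrier (poly_ring n)" "q \<in> carrier (poly_ring n)" "i \<noteq> j"
    and eq: "p * monomial (var_expo j) + q * monomial (var_expo i) = 0"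
  obtains r where "r \<in> carrier (poly_ring n)"
    "p = - (r * monomial (var_expo i))" "q = r * monomial (var_expo j)"
proof -
  have "expo_dvd (var_expo j) m" if "m \<in> Poly_Mapping.keys q" for m
  proof -
    have "q * monomial (var_expo i) = (- p) * monomial (var_expo j)"
      using eq by (simp add: eq_neg_iff_add_eq_0 add.commute)
    moreover have "m + var_expo i \<in> Poly_Mapping.keys (q * monomial (var_expo i))"
      using that by (simp add: in_keys_iff lookup_mult_monomial)
    ultimately obtain m' where "m + var_expo i = m' + var_expo j"
      using keys_mult[of "- p" "monomial (var_expo j)"] by auto
    from arg_cong[OF this, of "\<lambda>m. Poly_Mapping.lookup m j"] \<open>i \<noteq> j\<close>
    show ?thesis by (auto simp: expo_dvd_def lookup_expo)
  qed
  then obtain r where r: "r \<in> carrier (poly_ring n)" "q = r * monomial (var_expo j)"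
    using poly_divisible assms(2) by metis
  with eq have "(p + r * monomial (var_expo i)) * monomial (var_expo j) = 0"
    by (simp add: algebra_simps)
  then have "p = - (r * monomial (var_expo i))"
    by (simp add: eq_neg_iff_add_eq_0)
  with r that show thesis by blast
qed

section \<open>The polynomial ring as an abstract ring, and its ideals\<close>

lemma poly_ring_cring: "cring (poly_ring n :: 'k::field mpoly ring)"
proof (rule cringI)
  show "abelian_group (poly_ring n :: 'k mpoly ring)"
  proof (rule abelian_groupI)
    fix x :: "'k mpoly" assume "x \<in> carrier (poly_ring n)"
    then show "\<exists>y\<in>carrier (poly_ring n). y \<oplus>\<^bsub>poly_ring n\<^esub> x = \<zero>\<^bsub>poly_ring n\<^esub>"
      by (intro bexI[of _ "- x"]) auto
  qed (auto simp: algebra_simps)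
  show "Group.comm_monoid (poly_ring n :: 'k mpoly ring)"
    by (rule comm_monoidI) (auto simp: algebra_simps)
qed (auto simp: algebra_simps)

interpretation poly: cring "poly_ring n :: 'k::field mpoly ring" for n
  by (rule poly_ring_cring)

lemma poly_a_inv [simp]: "x \<in> carrier (poly_ring n) \<Longrightarrow> \<ominus>\<^bsub>poly_ring n\<^esub> x = - x"
  by (rule poly.minus_equality) auto

lemma poly_idealI:
  fixes A :: "'k::field mpoly set"
  assumes "A \<subseteq> carrier (poly_ring n)" "0 \<in> A"
    and "\<And>p q. p \<in> A \<Longrightarrow> q \<in> A \<Longrightarrow> p + q \<in> A"
    and mult: "\<And>r p. r \<in> carrier (poly_ring n) \<Longrightarrow> p \<in> A \<Longrightarrow> r * p \<in> A"
  shows "ideal A (poly_ring n)"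
proof (rule idealI[OF poly.ring_axioms])
  show "subgroup A (add_monoid (poly_ring n))"
  proof (rule poly.add.subgroupI)
    fix p assume "p \<in> A"
    then show "\<ominus>\<^bsub>poly_ring n\<^esub> p \<in> A"
      using mult[of "- 1" p] assms(1) by (auto simp: subset_iff)
  qed (use assms in auto)
  fix p r :: "'k mpoly" assume "p \<in> A" "r \<in> carrier (poly_ring n)"
  then show "r \<otimes>\<^bsub>poly_ring n\<^esub> p \<in> A" "p \<otimes>\<^bsub>poly_ring n\<^esub> r \<in> A"
    using mult[of r p] by (simp_all add: mult.commute)
qed

lemma poly_ideal_closed:
  fixes A :: "'k::field mpoly set"
  assumes "ideal A (poly_ring n)"
  shows poly_ideal_zero: "0 \<in> A"
    and poly_ideal_add: "p \<in> A \<Longrightarrow> q \<in> A \<Longrightarrow> p + q \<in> A"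
    and poly_ideal_mult: "r \<in> carrier (poly_ring n) \<Longrightarrow> p \<in> A \<Longrightarrow> r * p \<in> A"
proof -
  interpret ideal A "poly_ring n" by fact
  show "0 \<in> A" "p \<in> A \<Longrightarrow> q \<in> A \<Longrightarrow> p + q \<in> A"
    using zero_closed a_closed by auto
  show "r \<in> carrier (poly_ring n) \<Longrightarrow> p \<in> A \<Longrightarrow> r * p \<in> A"
    using I_l_closed[of p r] by simp
qed

lemma poly_ideal_sum:
  assumes "ideal A (poly_ring n)" "\<And>c. c \<in> C \<Longrightarrow> f c \<in> A"
  shows "(\<Sum>c\<in>C. f c) \<in> A"
  using assms(2) by (induction C rule: infinite_finite_induct)
    (auto intro: poly_ideal_zero[OF assms(1)] poly_ideal_add[OF assms(1)])

text \<open>Turns membership in the dual ideal into membership in the image of the differential on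
  vertices: the coefficients \<open>v\<close> become coordinates.\<close>

lemma genideal_eq_combinations:
  fixes f :: "'c \<Rightarrow> 'k::field mpoly"
  assumes "finite C" and f: "\<And>c. c \<in> C \<Longrightarrow> f c \<in> carrier (poly_ring n)"
  shows "genideal (poly_ring n) (f ` C)
       = {\<Sum>c\<in>C. v c * f c | v. \<forall>c \<in> C. v c \<in> carrier (poly_ring n)}" (is "_ = ?S")
proof
  have "ideal ?S (poly_ring n)"
  proof (rule poly_idealI)
    show "?S \<subseteq> carrier (poly_ring n)" using f by auto
    show "0 \<in> ?S" by (intro CollectI exI[of _ "\<lambda>c. 0"]) simp
    fix p q assume "p \<in> ?S" "q \<in> ?S"
    then obtain v w where "\<forall>c \<in> C. v c \<in> carrier (poly_ring n)" "\<forall>c \<in> C. w c \<in> carrier (poly_ring n)"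
      "p = (\<Sum>c\<in>C. v c * f c)" "q = (\<Sum>c\<in>C. w c * f c)" by auto
    then show "p + q \<in> ?S"
      by (intro CollectI exI[of _ "\<lambda>c. v c + w c"]) (simp add: sum.distrib distrib_right)
  next
    fix r p :: "'k mpoly" assume "r \<in> carrier (poly_ring n)" "p \<in> ?S"
    then obtain v where "\<forall>c \<in> C. v c \<in> carrier (poly_ring n)" "p = (\<Sum>c\<in>C. v c * f c)" by auto
    with \<open>r \<in> _\<close> show "r * p \<in> ?S"
      by (intro CollectI exI[of _ "\<lambda>c. r * v c"]) (simp add: sum_distrib_left mult.assoc)
  qed
  moreover have "f c \<in> ?S" if "c \<in> C" for c
  proof -
    have "(\<Sum>b\<in>C. (if b = c then 1 else 0) * f b) = (\<Sum>b\<in>C. if b = c then f b else 0)"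
      by (rule sum.cong) auto
    with that \<open>finite C\<close> show ?thesis
      by (intro CollectI exI[of _ "\<lambda>b. if b = c then 1 else 0"]) simp
  qed
  ultimately show "genideal (poly_ring n) (f ` C) \<subseteq> ?S"
    by (intro poly.genideal_minimal) auto
next
  have sub: "f ` C \<subseteq> carrier (poly_ring n)" using f by auto
  have id: "ideal (genideal (poly_ring n) (f ` C)) (poly_ring n)"
    by (rule poly.genideal_ideal[OF sub])
  have "f c \<in> genideal (poly_ring n) (f ` C)" if "c \<in> C" for c
    using poly.genideal_self[OF sub] that by blast
  then show "?S \<subseteq> genideal (poly_ring n) (f ` C)"
    by (auto intro!: poly_ideal_sum[OF id] poly_ideal_mult[OF id])
qed

lemma irrelevant_ideal_ideal: "ideal (irrelevant_ideal n) (poly_ring n)"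
  unfolding irrelevant_ideal_def by (rule poly.genideal_ideal) auto

lemma monomial_in_irrelevant_ideal:
  assumes "Poly_Mapping.keys m \<subseteq> {1..n}" "m \<noteq> 0"
  shows "(monomial m :: 'k::field mpoly) \<in> irrelevant_ideal n"
proof -
  obtain i where i: "i \<in> Poly_Mapping.keys m"
    using \<open>m \<noteq> 0\<close> by (metis ex_in_conv keys_eq_empty)
  then have "expo_dvd (var_expo i) m"
    by (auto simp: expo_dvd_def lookup_single when_def in_keys_iff)
  then have "(monomial m :: 'k mpoly) = monomial (m - var_expo i) * monomial (var_expo i)"
    by (simp add: monomial_mult expo_dvd_diff_add)
  moreover have "(monomial (var_expo i) :: 'k mpoly) \<in> irrelevant_ideal n"
    unfolding irrelevant_ideal_def
    using i assms by (intro subsetD[OF poly.genideal_self] CollectI exI[of _ i]) auto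
  moreover have "Poly_Mapping.keys (m - var_expo i) \<subseteq> {1..n}"
    using keys_expo_diff assms(1) by blast
  ultimately show ?thesis
    by (simp add: poly_ideal_mult[OF irrelevant_ideal_ideal])
qed

section \<open>Minimal generators of an ideal with quadratic monomial generators\<close>

lemma keys_gen_expo: "Poly_Mapping.keys (gen_expo c) = {fst c, snd c}"
  by (auto simp: gen_expo_def in_keys_iff lookup_expo split: if_splits)

lemma expo_dvd_trans: "expo_dvd l m \<Longrightarrow> expo_dvd m m' \<Longrightarrow> expo_dvd l m'"
  unfolding expo_dvd_def using order_trans by blast

lemma expo_dvd_antisym: "expo_dvd l m \<Longrightarrow> expo_dvd m l \<Longrightarrow> l = m"
  unfolding expo_dvd_def by (rule poly_mapping_eqI) (simp add: antisym)

text \<open>Both monomials have degree two. The points themselves can differ: \<open>(i, j)\<close>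
  and \<open>(j, i)\<close> have the same exponent.\<close>

lemma gen_expo_dvd_imp_eq:
  assumes "expo_dvd (gen_expo c) (gen_expo c')"
  shows "gen_expo c = gen_expo c'"
proof -
  obtain i j p q where c: "c = (i, j)" "c' = (p, q)" by (metis surj_pair)
  have "i = p \<and> j = q \<or> i = q \<and> j = p"
    using spec[OF assms[unfolded expo_dvd_def], of i] spec[OF assms[unfolded expo_dvd_def], of j]
    by (auto simp: c gen_expo_def lookup_expo split: if_splits)
  then show ?thesis by (auto simp: c gen_expo_def add.commute)
qed

text \<open>The polynomials all of whose monomials are divisible by some generator form an ideal. It
  bounds the generated ideal from above, so every monomial of the latter is divisible by a
  generator; in degree two no generator properly divides another.\<close>

lemma min_gens_quadratic:
  assumes C: "\<And>c. c \<in> C \<Longrightarrow> Poly_Mapping.keys (gen_expo c) \<subseteq> {1..n}"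
  shows "min_gens (genideal (poly_ring n) {monomial (gen_expo c) :: 'k::field mpoly | c. c \<in> C})
       = gen_expo ` C"
proof -
  define I where "I = genideal (poly_ring n) {monomial (gen_expo c) :: 'k mpoly | c. c \<in> C}"
  let ?S = "{p \<in> carrier (poly_ring n). \<forall>m \<in> Poly_Mapping.keys p. \<exists>c \<in> C. expo_dvd (gen_expo c) m}"
  have "ideal ?S (poly_ring n :: 'k mpoly ring)"
  proof (rule poly_idealI)
    fix p q :: "'k mpoly" assume "p \<in> ?S" "q \<in> ?S"
    then show "p + q \<in> ?S" using keys_add[of p q] by auto
  next
    fix r p :: "'k mpoly" assume r: "r \<in> carrier (poly_ring n)" and p: "p \<in> ?S"
    show "r * p \<in> ?S"
    proof (intro CollectI conjI ballI)
      fix m assume "m \<in> Poly_Mapping.keys (r * p)"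
      then obtain l l' where m: "m = l + l'" and "l' \<in> Poly_Mapping.keys p"
        using keys_mult[of r p] by blast
      with p obtain c where "c \<in> C" "expo_dvd (gen_expo c) l'" by auto
      then show "\<exists>c \<in> C. expo_dvd (gen_expo c) m"
        by (auto simp: m expo_dvd_def lookup_add intro!: bexI[of _ c] trans_le_add2)
    qed (use r p in auto)
  qed auto
  moreover have "{monomial (gen_expo c) | c. c \<in> C} \<subseteq> ?S"
    using C by (auto simp: expo_dvd_def)
  ultimately have sub: "I \<subseteq> ?S" unfolding I_def by (rule poly.genideal_minimal)
  have gen: "monomial (gen_expo c) \<in> I" if "c \<in> C" for c
    unfolding I_def by (rule subsetD[OF poly.genideal_self]) (use C that in \<open>auto simp del: split_paired_Ex\<close>)
  have dvd: "\<exists>c \<in> C. expo_dvd (gen_expo c) m" if "monomial m \<in> I" for m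
    using subsetD[OF sub that] by simp
  show ?thesis
    unfolding I_def[symmetric] min_gens_def
  proof (intro equalityI subsetI)
    fix m assume "m \<in> {m. monomial m \<in> I \<and> (\<forall>m'. monomial m' \<in> I \<and> expo_dvd m' m \<longrightarrow> m' = m)}"
    then show "m \<in> gen_expo ` C" using dvd gen by blast
  next
    fix m assume "m \<in> gen_expo ` C"
    then obtain c where c: "c \<in> C" "m = gen_expo c" by auto
    have "m' = m" if m': "monomial m' \<in> I" "expo_dvd m' m" for m'
    proof -
      obtain c' where c': "c' \<in> C" "expo_dvd (gen_expo c') m'" using dvd m'(1) by blast
      then have "gen_expo c' = m"
        using gen_expo_dvd_imp_eq expo_dvd_trans m'(2) c(2) by blast
      then show ?thesis using expo_dvd_antisym c'(2) m'(2) by blast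
    qed
    then show "m \<in> {m. monomial m \<in> I \<and> (\<forall>m'. monomial m' \<in> I \<and> expo_dvd m' m \<longrightarrow> m' = m)}"
      using c gen by blast
  qed
qed

section \<open>Compatible diagrams\<close>

text \<open>Models the left side of a rectangle: \<open>S\<close> will be the set of rows that meet
  its column, and consecutive elements of \<open>S\<close> are the ends of a vertical good
  move.\<close>

lemma sum_consecutive_telescope:
  fixes g :: "nat \<Rightarrow> 'b::ab_group_add"
  assumes "finite S" "S \<noteq> {}"
  shows "(\<Sum>(s, r) \<in> {(s, r). s \<in> S \<and> r \<in> S \<and> s < r \<and> (\<forall>t. s < t \<and> t < r \<longrightarrow> t \<notin> S)}. g s - g r)
         = g (Min S) - g (Max S)"
  using assms
proof (induction S rule: finite_linorder_max_induct)
  case (insert b A)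
  define Pairs where
    "Pairs S = {(s, r). s \<in> S \<and> r \<in> S \<and> s < r \<and> (\<forall>t. s < t \<and> t < r \<longrightarrow> t \<notin> S)}" for S :: "nat set"
  show ?case
  proof (cases "A = {}")
    case True
    then show ?thesis by (auto intro!: sum.neutral)
  next
    case False
    have "Min (insert b A) = Min A"
      using insert.hyps False by (simp add: less_imp_le min_absorb2)
    moreover have "Max (insert b A) = b"
      using insert.hyps by (intro Max_eqI) (auto simp: less_imp_le)
    ultimately have Min_Max: "Min (insert b A) = Min A" "Max (insert b A) = b" .
    \<comment> \<open>A new maximum creates one new consecutive pair and destroys none.\<close>
    have "Pairs (insert b A) = insert (Max A, b) (Pairs A)"
    proof (intro equalityI subrelI)
      fix s r assume "(s, r) \<in> Pairs (insert b A)"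
      then have *: "s \<in> insert b A" "r \<in> insert b A" "s < r" "\<And>t. s < t \<Longrightarrow> t < r \<Longrightarrow> t \<notin> insert b A"
        by (auto simp: Pairs_def)
      have "s \<in> A" using * insert.hyps by force
      show "(s, r) \<in> insert (Max A, b) (Pairs A)"
      proof (cases "r = b")
        case True
        have "\<not> s < Max A" using *(4)[of "Max A"] True insert.hyps False by auto
        then have "s = Max A" using Max_ge[OF insert.hyps(1) \<open>s \<in> A\<close>] by simp
        with True show ?thesis by simp
      next
        case False
        with * \<open>s \<in> A\<close> show ?thesis by (auto simp: Pairs_def)
      qed
    next
      fix s r assume "(s, r) \<in> insert (Max A, b) (Pairs A)"
      then show "(s, r) \<in> Pairs (insert b A)"
      proof
        assume "(s, r) = (Max A, b)"
        moreover have "Max A \<in> A" using insert.hyps(1) False by simp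
        moreover have "t \<notin> A" if "Max A < t" for t
          using Max_ge[OF insert.hyps(1), of t] that by linarith
        ultimately show ?thesis using insert.hyps(2) by (simp add: Pairs_def)
      next
        assume "(s, r) \<in> Pairs A"
        then show ?thesis using insert.hyps(2) by (auto simp: Pairs_def)
      qed
    qed
    moreover have "(Max A, b) \<notin> Pairs A" using insert.hyps by (auto simp: Pairs_def)
    moreover have "finite (Pairs A)"
      by (rule finite_subset[of _ "A \<times> A"]) (auto simp: Pairs_def insert.hyps(1))
    ultimately have "(\<Sum>(s, r) \<in> Pairs (insert b A). g s - g r)
        = g (Max A) - g b + (\<Sum>(s, r) \<in> Pairs A. g s - g r)"
      by simp
    also have "\<dots> = g (Min A) - g b"
      using insert.IH[OF False] by (simp add: Pairs_def)
    finally show ?thesis unfolding Pairs_def Min_Max .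
  qed
qed simp

locale compatible_diagram =
  fixes n h :: nat and lam mu :: "nat \<Rightarrow> nat"
  assumes shifted: "shifted_partition h lam mu"
    and lam_le: "\<forall>i \<in> {1..h}. lam i \<le> n"
    and connected: "connected_diagram h lam mu"
    and compatible: "compatible h lam mu"
begin

abbreviation "D \<equiv> diagram h lam mu"
abbreviation "good \<equiv> good_move h lam mu"

section \<open>Shape of the rows and of the order, from condition (a)\<close>

lemma mem_D: "(i, j) \<in> D \<longleftrightarrow> 1 \<le> i \<and> i \<le> h \<and> mu i < j \<and> j \<le> lam i"
  by (simp add: diagram_def)

lemma D_bounds: "(i, j) \<in> D \<Longrightarrow> 1 \<le> i \<and> i \<le> j \<and> j \<le> n \<and> i \<le> h"
  using shifted lam_le by (force simp: mem_D shifted_partition_def)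

lemma finite_D: "finite D"
  by (rule finite_subset[of _ "{..h} \<times> {..n}"]) (use D_bounds in auto)

text \<open>If \<open>mu\<close> dropped, the order of the lower row would begin at a column
  \<open>t\<close> that is not its first one and continue with \<open>t - 1\<close>. The move from
  \<open>t - 1\<close> to \<open>t\<close> would then be good and point east, against (a).\<close>

lemma mu_Suc_le: "1 \<le> i \<Longrightarrow> i < h \<Longrightarrow> mu i \<le> mu (Suc i)"
proof (rule ccontr)
  assume i: "1 \<le> i" "i < h" "\<not> mu i \<le> mu (Suc i)"
  define S where "S = {mu i<..lam i} \<inter> {mu (Suc i)<..lam (Suc i)}"
  have S: "finite S" "S \<noteq> {}"
    using connected i by (auto simp: S_def connected_diagram_def)
  define t where "t = Min S"
  have "t \<in> S" unfolding t_def using Min_in S by blast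
  then have t: "(Suc i, t) \<in> D" "(Suc i, t - 1) \<in> D" "t - 1 < t"
    using i by (auto simp: mem_D S_def)
  have "minimal_move D (Suc i, t - 1) (Suc i, t)"
    using t by (auto simp: minimal_move_def box_def)
  moreover have "prec lam mu (Suc i, t) (Suc i, t - 1)"
    using t(3) i by (simp add: prec_def row_prec_def row_start_def t_def S_def)
  ultimately have "good (Suc i, t - 1) (Suc i, t)" by (simp add: good_move_def)
  then show False using compatible t(3) unfolding compatible_def by force
qed

lemma mu_mono: "i \<le> i' \<Longrightarrow> 1 \<le> i \<Longrightarrow> i' \<le> h \<Longrightarrow> mu i \<le> mu i'"
proof (induction i' rule: dec_induct)
  case (step i')
  then show ?case using mu_Suc_le[of i'] by simp
qed simp

text \<open>As \<open>mu\<close> increases weakly, the common columns of two adjacent rows begin at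
  the first column of the lower one. The westward part of the row order thus shrinks to a single
  point.\<close>

lemma row_start_eq:
  assumes "1 \<le> i" "i < h"
  shows "mu (Suc i) < lam i" "row_start lam mu (Suc i) = Suc (mu (Suc i))"
proof -
  have "{mu i<..lam i} \<inter> {mu (Suc i)<..lam (Suc i)} \<noteq> {}"
    using connected assms by (auto simp: connected_diagram_def)
  then show *: "mu (Suc i) < lam i" by force
  have "mu (Suc i) < lam (Suc i)"
    using shifted assms by (simp add: shifted_partition_def)
  with * show "row_start lam mu (Suc i) = Suc (mu (Suc i))"
    using mu_Suc_le[OF assms] unfolding row_start_def by (intro Min_eqI) auto
qed

lemma prec_iff:
  assumes "(i, j) \<in> D" "(p, q) \<in> D"
  shows "prec lam mu (p, q) (i, j) \<longleftrightarrow> p < i \<or> p = i \<and> q < j"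
proof (cases "i = 1")
  case False
  then obtain i' where i': "i = Suc i'" "1 \<le> i'" using D_bounds[OF assms(1)] by (cases i) auto
  then have "row_start lam mu i = Suc (mu i)"
    using row_start_eq(2)[of i'] assms by (simp add: mem_D)
  then show ?thesis
    using assms False by (auto simp: prec_def row_prec_def mem_D)
qed (auto simp: prec_def row_prec_def)

text \<open>Provides a northward good move at the first point of every row except the top
  one.\<close>

lemma above_row_start:
  assumes "(i, j) \<in> D" "2 \<le> i"
  shows "(i - 1, Suc (mu i)) \<in> D"
proof -
  obtain i' where i': "i = Suc i'" "1 \<le> i'" "i' < h"
    using assms D_bounds[OF assms(1)] by (cases i) auto
  then show ?thesis using row_start_eq(1)[of i'] mu_Suc_le[of i'] by (simp add: mem_D)
qed

text \<open>Rows are intervals, so a horizontal minimal move is a unit step; a vertical one can jump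
  over a gap of its column.\<close>

lemma good_move_iff:
  "good (i, j) (p, q) \<longleftrightarrow> (i, j) \<in> D \<and> (p, q) \<in> D \<and>
     (p = i \<and> j = Suc q \<or> q = j \<and> p < i \<and> (\<forall>t. p < t \<and> t < i \<longrightarrow> (t, j) \<notin> D))"
proof (cases "(i, j) \<in> D \<and> (p, q) \<in> D")
  case True
  then have pr: "prec lam mu (p, q) (i, j) \<longleftrightarrow> p < i \<or> p = i \<and> q < j"
    by (simp add: prec_iff)
  show ?thesis
  proof (cases "p = i")
    case True
    have "D \<inter> box (i, j) (i, q) = {(i, j), (i, q)} \<longleftrightarrow> j = Suc q" if "q < j"
    proof
      assume *: "D \<inter> box (i, j) (i, q) = {(i, j), (i, q)}"
      show "j = Suc q"
      proof (rule ccontr)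
        assume "j \<noteq> Suc q"
        then have "(i, Suc q) \<in> D \<inter> box (i, j) (i, q)"
          using that \<open>(i, j) \<in> D \<and> (p, q) \<in> D\<close> True by (auto simp: mem_D box_def)
        then show False using * that \<open>j \<noteq> Suc q\<close> by auto
      qed
    qed (use \<open>(i, j) \<in> D \<and> (p, q) \<in> D\<close> True in \<open>auto simp: mem_D box_def\<close>)
    then show ?thesis using True \<open>(i, j) \<in> D \<and> (p, q) \<in> D\<close> pr
      by (cases "q < j") (simp_all add: good_move_def minimal_move_def)
  next
    case False
    have "D \<inter> box (i, j) (p, j) = {(i, j), (p, j)} \<longleftrightarrow> (\<forall>t. p < t \<and> t < i \<longrightarrow> (t, j) \<notin> D)"
      if less: "p < i" "q = j"
    proof
      assume *: "D \<inter> box (i, j) (p, j) = {(i, j), (p, j)}"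
      show "\<forall>t. p < t \<and> t < i \<longrightarrow> (t, j) \<notin> D"
      proof (intro allI impI notI)
        fix t assume t: "p < t \<and> t < i" "(t, j) \<in> D"
        then have "(t, j) \<in> D \<inter> box (i, j) (p, j)" by (auto simp: box_def)
        then show False using * t by auto
      qed
    next
      assume *: "\<forall>t. p < t \<and> t < i \<longrightarrow> (t, j) \<notin> D"
      show "D \<inter> box (i, j) (p, j) = {(i, j), (p, j)}"
      proof (intro equalityI subsetI)
        fix c assume c: "c \<in> D \<inter> box (i, j) (p, j)"
        then obtain t where "c = (t, j)" "p \<le> t" "t \<le> i" using less c by (cases c) (auto simp: box_def)
        then show "c \<in> {(i, j), (p, j)}" using * c by (cases "t = p \<or> t = i") auto
      qed (use True less in \<open>auto simp: box_def\<close>)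
    qed
    then show ?thesis using False True pr
      by (cases "p < i"; cases "q = j") (simp_all add: good_move_def minimal_move_def)
  qed
qed (auto simp: good_move_def minimal_move_def)

lemma good_west: "(i, j) \<in> D \<Longrightarrow> (i, j - 1) \<in> D \<Longrightarrow> good (i, j) (i, j - 1)"
  by (auto simp: good_move_iff mem_D)

lemma good_north_exists:
  assumes "(i, j) \<in> D" "(p, j) \<in> D" "p < i"
  obtains p' where "good (i, j) (p', j)" "p' < i"
proof -
  define S where "S = {t. t < i \<and> (t, j) \<in> D}"
  have S: "finite S" "p \<in> S" using assms by (auto simp: S_def)
  obtain m where m: "m \<in> S" "\<And>t. m < t \<Longrightarrow> t \<notin> S"
    using S Max_in[of S] Max_ge[of S] by (metis empty_iff not_le)
  then have "good (i, j) (m, j)" "m < i"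
    using assms(1) by (auto simp: good_move_iff S_def)
  then show thesis using that by blast
qed

lemma good_north_unique: "good (i, j) (p, j) \<Longrightarrow> good (i, j) (q, j) \<Longrightarrow> p = q"
  by (rule linorder_cases[of p q]) (auto simp: good_move_iff)

text \<open>The only use of condition (b): at the first point \<open>(i, j)\<close> of row \<open>i\<close> there is no horizontal good
  move, whereas both \<open>i\<close> and \<open>j\<close> would lie in its set \<open>X\<close> if \<open>(i, i)\<close> were missing.\<close>

lemma diagonal_in_D:
  assumes "1 \<le> i" "i \<le> h" "p < i" "(p, i) \<in> D"
  shows "(i, i) \<in> D"
proof (rule ccontr)
  assume ni: "(i, i) \<notin> D"
  define j where "j = Suc (mu i)"
  have c: "(i, j) \<in> D"
    using bspec[OF shifted[unfolded shifted_partition_def], of i] assms by (simp add: j_def mem_D)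
  have ij: "i < j" using ni c D_bounds[OF c] by (cases "i = j") auto
  have i2: "2 \<le> i" using assms D_bounds[OF assms(4)] by simp
  have above: "(i - 1, j) \<in> D" using above_row_start[OF c i2] by (simp add: j_def)
  \<comment> \<open>The earlier point \<open>(p, i)\<close> trades x_j for x_p; below, the point
    directly above \<open>(i, j)\<close> trades x_i for x_(i-1).\<close>
  have "j \<in> X_set h lam mu (i, j)"
    unfolding X_set_def using assms ij
    by (intro CollectI exI[of _ p] bexI[of _ "(p, i)"])
      (auto simp: prec_iff[OF c assms(4)] gen_expo_def algebra_simps)
  moreover have "i \<in> X_set h lam mu (i, j)"
    unfolding X_set_def using i2 above
    by (intro CollectI exI[of _ "i - 1"] bexI[of _ "(i - 1, j)"])
      (auto simp: prec_iff[OF c above, simplified] gen_expo_def algebra_simps)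
  \<comment> \<open>A variable that is traded away divides x_i x_j, so there is no third
    element.\<close>
  moreover have "k \<in> {i, j}" if k: "k \<in> X_set h lam mu (i, j)" for k
  proof -
    obtain l c' where l: "l \<noteq> k"
      "gen_expo c' + var_expo k = gen_expo (i, j) + var_expo l"
      using k unfolding X_set_def by blast
    from arg_cong[OF l(2), of "\<lambda>m. Poly_Mapping.lookup m k"] l(1) show ?thesis
      by (auto simp: gen_expo_def lookup_expo split: if_splits)
  qed
  ultimately have "X_set h lam mu (i, j) = {i, j}" by auto
  with ij have "card {c'. good (i, j) c'} = 2"
    using compatible c unfolding compatible_def by simp
  \<comment> \<open>Nothing lies west of the first point of a row, so every good move goes north,
    and there is at most one such move.\<close>
  moreover have "snd c' = j" if "good (i, j) c'" for c'
    using that by (cases c') (auto simp: good_move_iff mem_D j_def)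
  then have "c' = c''" if "good (i, j) c'" "good (i, j) c''" for c' c''
    using that good_north_unique[of i j "fst c'" "fst c''"] by (metis prod.collapse)
  then obtain x where "{c'. good (i, j) c'} \<subseteq> {x}" by blast
  then have "card {c'. good (i, j) c'} \<le> card {x}" by (rule card_mono[rotated]) simp
  ultimately show False by simp
qed

text \<open>The linear quotient property: by the divisibility hypothesis \<open>x\<^bsup>m\<^esup>\<close> multiplies the dual generator
  of \<open>(i, j)\<close> into the ideal of an earlier one.\<close>

lemma colon_monomial:
  assumes c: "(i, j) \<in> D" and c': "(p, q) \<in> D" and less: "p < i \<or> p = i \<and> q < j"
    and dvd: "expo_dvd (gen_expo (i, j)) (m + gen_expo (p, q))"
  shows "(i, j - 1) \<in> D \<and> expo_dvd (var_expo j) m \<or>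
         (\<exists>t. good (i, j) (t, j) \<and> t < i) \<and> expo_dvd (var_expo i) m"
proof -
  have at: "Poly_Mapping.lookup (gen_expo (i, j)) x
      \<le> Poly_Mapping.lookup m x + Poly_Mapping.lookup (gen_expo (p, q)) x" for x
    using dvd by (simp add: expo_dvd_def lookup_add)
  have var: "expo_dvd (var_expo x) m" if "Poly_Mapping.lookup m x > 0" for x
    using that by (auto simp: expo_dvd_def lookup_expo)
  note b = D_bounds[OF c] D_bounds[OF c']
  show ?thesis
  proof (cases "p = i")
    case True
    then have "(i, j - 1) \<in> D" using less c c' by (auto simp: mem_D)
    moreover have "Poly_Mapping.lookup m j > 0"
      using at[of j] True less b by (auto simp: gen_expo_def lookup_expo split: if_splits)
    ultimately show ?thesis using var by blast
  next
    case False
    then have "p < i" using less by simp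
    show ?thesis
    proof (cases "q = j")
      case True
      have "Poly_Mapping.lookup m i > 0"
        using at[of i] True \<open>p < i\<close> b by (auto simp: gen_expo_def lookup_expo split: if_splits)
      moreover obtain t where "good (i, j) (t, j)" "t < i"
        using good_north_exists[OF c _ \<open>p < i\<close>] c' True by blast
      ultimately show ?thesis using var by blast
    next
      case False
      \<comment> \<open>Since \<open>q\<close> differs from \<open>j\<close> and p < i \<le> j, the
        monomial of \<open>(p, q)\<close> lacks x_j, so \<open>m\<close> must supply it.\<close>
      have mj: "Poly_Mapping.lookup m j > 0"
        using at[of j] False \<open>p < i\<close> b by (auto simp: gen_expo_def lookup_expo split: if_splits)
      show ?thesis
      proof (cases "(i, j - 1) \<in> D")
        case True
        then show ?thesis using mj var by blast
      next
        \<comment> \<open>At the first point of the row only the northward move is left, so x_i has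
          to divide the monomial of \<open>m\<close> too.\<close>
        case nw: False
        then have j: "j = Suc (mu i)" using c by (auto simp: mem_D)
        have "2 \<le> i" using \<open>p < i\<close> b by simp
        then have "(i - 1, j) \<in> D" "i - 1 < i" using above_row_start[OF c] j by auto
        then obtain t where t: "good (i, j) (t, j)" "t < i"
          using good_north_exists[OF c] by blast
        \<comment> \<open>If \<open>q = i\<close>, the earlier monomial would itself supply x_i. The
          diagonal point excludes this: it forces the first column \<open>j\<close> of the row to be
          \<open>i\<close>, hence \<open>q = j\<close>.\<close>
        have "q \<noteq> i"
        proof
          assume "q = i"
          then have "(i, i) \<in> D" using diagonal_in_D \<open>p < i\<close> b c' by blast
          then show False using j b False \<open>q = i\<close> by (auto simp: mem_D)
        qed
        then have "Poly_Mapping.lookup m i > 0"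
          using at[of i] \<open>p < i\<close> by (auto simp: gen_expo_def lookup_expo split: if_splits)
        then show ?thesis using t var by blast
      qed
    qed
  qed
qed

end

section \<open>The cellular complex\<close>

lemma free_module_sel [simp]:
  "zero (free_module n B deg) = (\<lambda>b. 0)"
  "add (free_module n B deg) = (\<lambda>v w b. v b + w b)"
  "smult (free_module n B deg) = (\<lambda>r v b. r * v b)"
  by (simp_all add: free_module_def)

lemma free_module_carrier:
  "v \<in> carrier (free_module n B deg) \<longleftrightarrow>
     (\<forall>b \<in> B. v b \<in> carrier (poly_ring n)) \<and> (\<forall>b. b \<notin> B \<longrightarrow> v b = 0)"
  by (simp add: free_module_def)

lemma free_module_component:
  "v \<in> component (free_module n B deg) \<gamma> \<longleftrightarrow> v \<in> carrier (free_module n B deg) \<and>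
     (\<forall>b \<in> B. \<forall>m \<in> Poly_Mapping.keys (v b). m + deg b = \<gamma>)"
  by (auto simp: free_module_def)

lemma cells_0: "cells h lam mu 0 = {EmptyFace}"
  by (auto simp: cells_def cell_complex_def)

lemma cells_1: "cells h lam mu (Suc 0) = Vertex ` diagram h lam mu"
  by (auto simp: cells_def cell_complex_def)

lemma cells_2: "cells h lam mu (Suc (Suc 0)) = (\<lambda>(c, c'). Edge c c') ` {(c, c'). good_move h lam mu c c'}"
  by (force simp: cells_def cell_complex_def)

lemma cells_3: "cells h lam mu (Suc (Suc (Suc 0))) =
  {Rect i j i' | i j i'. good_move h lam mu (i, j) (i, j - 1) \<and> good_move h lam mu (i, j) (i', j) \<and> i' < i}"
  by (force simp: cells_def cell_complex_def)

lemma cells_ge_4: "cells h lam mu (Suc (Suc (Suc (Suc i)))) = {}"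
  by (auto simp: cells_def cell_complex_def)

lemma cells_4_cases: obtains "i = 0" | "i = Suc 0" | "i = Suc (Suc 0)" | "i = Suc (Suc (Suc 0))"
  | i' where "i = Suc (Suc (Suc (Suc i')))"
  by (metis not0_implies_Suc)

lemma cellular_map_add:
  "cellular_map h lam mu a i (\<lambda>b. v b + w b) Q = cellular_map h lam mu a i v Q + cellular_map h lam mu a i w Q"
  by (simp add: cellular_map_def distrib_right sum.distrib)

lemma cellular_map_mult:
  "cellular_map h lam mu a i (\<lambda>b. r * v b) Q = r * cellular_map h lam mu a i v Q"
  by (simp add: cellular_map_def sum_distrib_left mult.assoc)

lemma cellular_map_zero: "cellular_map h lam mu a i (\<lambda>b. 0) Q = 0"
  by (simp add: cellular_map_def)

lemma cellular_map_diff: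
  "cellular_map h lam mu a i (\<lambda>b. v b - w b) Q = cellular_map h lam mu a i v Q - cellular_map h lam mu a i w Q"
  by (simp add: cellular_map_def left_diff_distrib sum_subtractf)

text \<open>The last vertex of a cell in the order, along which cycles are eliminated. The value
  \<open>(0, 0)\<close> is a dummy that lies in no diagram.\<close>

fun corner :: "face \<Rightarrow> point" where
  "corner EmptyFace = (0, 0)"
| "corner (Vertex c) = c"
| "corner (Edge c c') = c"
| "corner (Rect i j i') = (i, j)"

text \<open>Agrees with \<open>prec\<close> on the diagram by \<open>prec_iff\<close>, and is total
  on all points, so that comparisons can be made without membership in \<open>D\<close>.\<close>

definition before :: "point \<Rightarrow> point \<Rightarrow> bool" where
  "before c c' \<longleftrightarrow> fst c < fst c' \<or> fst c = fst c' \<and> snd c < snd c'"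

definition coordinate :: "face \<Rightarrow> 'k::field mpoly \<Rightarrow> face \<Rightarrow> 'k mpoly" where
  "coordinate P r = (\<lambda>b. if b = P then r else 0)"

text \<open>A cofactor \<open>u\<close> of the two variables in \<open>a\<close> is split off before
  the truncated differences are computed. The case \<open>x = y\<close> is included; it occurs at
  points on the diagonal.\<close>

lemma expo_diff_var:
  assumes "expo_dvd (var_expo x + var_expo y) a"
  shows "a - var_expo x - (a - (var_expo x + var_expo y)) = var_expo y"
    and "a - var_expo y - (a - (var_expo x + var_expo y)) = var_expo x"
    and "a - (a - var_expo x) = var_expo x" and "a - (a - var_expo y) = var_expo y"
proof -
  obtain u where a: "a = u + (var_expo x + var_expo y)"
    using expo_dvd_diff_add[OF assms] by metis
  have x: "a - var_expo x = u + var_expo y"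
    unfolding a by (metis add.assoc add.commute add_diff_cancel_right')
  have y: "a - var_expo y = u + var_expo x"
    unfolding a by (metis add.assoc add_diff_cancel_right')
  show "a - var_expo x - (a - (var_expo x + var_expo y)) = var_expo y"
    "a - var_expo y - (a - (var_expo x + var_expo y)) = var_expo x"
    unfolding x y by (simp_all add: a)
  show "a - (a - var_expo x) = var_expo x"
    unfolding x unfolding a by (metis add.assoc add.commute add_diff_cancel_left')
  show "a - (a - var_expo y) = var_expo y"
    unfolding y unfolding a by (metis add.assoc add_diff_cancel_left')
qed

locale cellular_resolution = compatible_diagram +
  fixes a :: expo
  assumes keys_a: "Poly_Mapping.keys a \<subseteq> {1..n}"
    and gen_dvd: "\<And>c. c \<in> diagram h lam mu \<Longrightarrow> expo_dvd (gen_expo c) a"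
begin

abbreviation "cls \<equiv> cells h lam mu"
abbreviation "d \<equiv> cellular_map h lam mu a"
abbreviation "F i \<equiv> free_module n (cls i) (label a)"

definition coef :: "face \<Rightarrow> face \<Rightarrow> 'k::field mpoly" where
  "coef Q P = of_int (incidence Q P) * monomial (label a P - label a Q)"

lemma d_apply: "d i v Q = (if Q \<in> cls i then \<Sum>P \<in> cls (Suc i). v P * coef Q P else 0)"
  by (simp add: cellular_map_def coef_def)

lemma finite_good: "finite {(c, c'). good c c'}"
  by (rule finite_subset[of _ "D \<times> D"]) (auto simp: good_move_iff finite_D)

lemma finite_cells: "finite (cls i)"
proof (cases i rule: cells_4_cases)
  case 4
  have "cls i \<subseteq> (\<lambda>(i, j, i'). Rect i j i') ` ({..h} \<times> {..n} \<times> {..h})"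
  proof
    fix P assume "P \<in> cls i"
    then obtain x y t where "P = Rect x y t" "good (x, y) (t, y)" by (auto simp: 4 cells_3)
    then show "P \<in> (\<lambda>(i, j, i'). Rect i j i') ` ({..h} \<times> {..n} \<times> {..h})"
      using D_bounds[of x y] D_bounds[of t y]
      by (auto simp: good_move_iff intro!: image_eqI[of _ _ "(x, y, t)"])
  qed
  then show ?thesis by (rule finite_subset) auto
qed (auto simp: cells_0 cells_1 cells_2 cells_ge_4 finite_D finite_good)

lemma edge_cases:
  assumes "good (x, y) c'"
  obtains "c' = (x, y - 1)" "(x, y - 1) \<in> D" | t where "c' = (t, y)" "t < x"
proof -
  obtain p q where c': "c' = (p, q)" by force
  show thesis using assms that unfolding c' good_move_iff by auto
qed

lemma good_before: "good c c' \<Longrightarrow> before c' c"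
  by (cases c; cases c') (auto simp: good_move_iff before_def)

lemma good_D: "good c c' \<Longrightarrow> c \<in> D \<and> c' \<in> D"
  by (simp add: good_move_def minimal_move_def)

lemma before_irrefl: "\<not> before c c"
  by (simp add: before_def)

lemma good_irrefl: "\<not> good c c"
  using good_before before_irrefl by blast

lemma before_total: "c \<noteq> c' \<Longrightarrow> before c c' \<or> before c' c"
  by (auto simp: before_def prod_eq_iff)

lemma corner_in_D: "P \<in> cls (Suc i) \<Longrightarrow> corner P \<in> D"
  by (cases i rule: cells_4_cases) (auto simp: cells_1 cells_2 cells_3 cells_ge_4 dest: good_D)

lemma label_west: "(x, y) \<in> D \<Longrightarrow> label a (Edge (x, y) (x, y')) - label a (Vertex (x, y)) = var_expo y"
  using expo_diff_var[of x y a] gen_dvd[of "(x, y)"] by (simp add: gen_expo_def)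

lemma label_north:
  "(x, y) \<in> D \<Longrightarrow> t < x \<Longrightarrow> label a (Edge (x, y) (t, y)) - label a (Vertex (x, y)) = var_expo x"
  using expo_diff_var[of x y a] gen_dvd[of "(x, y)"] by (simp add: gen_expo_def)

lemma label_rect_bottom:
  "(x, y) \<in> D \<Longrightarrow> label a (Rect x y t) - label a (Edge (x, y) (x, y')) = var_expo x"
  using expo_diff_var[of x y a] gen_dvd[of "(x, y)"] by (simp add: gen_expo_def)

lemma label_rect_right:
  "(x, y) \<in> D \<Longrightarrow> t < x \<Longrightarrow> label a (Rect x y t) - label a (Edge (x, y) (t, y)) = var_expo y"
  using expo_diff_var[of x y a] gen_dvd[of "(x, y)"] by (simp add: gen_expo_def)

text \<open>Makes the truncated difference in \<open>coef\<close> a true quotient of monomials.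
  Homogeneity of the differential and the vanishing of its square rest on this.\<close>

lemma label_mono:
  assumes "P \<in> cls (Suc i)" "incidence Q P \<noteq> 0"
  shows "expo_dvd (label a Q) (label a P)"
proof -
  have sub: "expo_dvd (a - m) a" for m by (simp add: expo_dvd_def lookup_minus)
  have sub2: "expo_dvd (a - (m + m')) (a - m)" "expo_dvd (a - (m' + m)) (a - m)" for m m'
    by (auto simp: expo_dvd_def lookup_expo)
  show ?thesis
  proof (cases P)
    case (Edge c c')
    then have "good c c'" using assms(1)
      by (cases i rule: cells_4_cases) (auto simp: cells_1 cells_2 cells_3 cells_ge_4)
    then have "fst c = fst c' \<or> snd c = snd c'" by (simp add: good_move_def minimal_move_def)
    moreover obtain q where "Q = Vertex q" "q = c \<or> q = c'"
      using assms(2) Edge by (cases Q) (auto split: if_splits)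
    ultimately show ?thesis using Edge sub2 by (auto simp: gen_expo_def)
  next
    case (Rect x y t)
    then show ?thesis using assms(2) sub by (cases Q) auto
  qed (use assms(2) in \<open>cases Q; auto simp: expo_dvd_def\<close>)+
qed

lemma keys_label: "Poly_Mapping.keys (label a P) \<subseteq> {1..n}"
  using keys_expo_diff[of a] keys_a by (cases P) (auto simp: subset_iff)

lemma coef_closed: "coef Q P \<in> carrier (poly_ring n)"
  unfolding coef_def using keys_expo_diff[of "label a P" "label a Q"] keys_label[of P]
  by (intro poly_mult_closed) auto

lemma d_closed: "v \<in> carrier (F (Suc i)) \<Longrightarrow> d i v \<in> carrier (F i)"
  by (auto simp: free_module_carrier d_apply coef_closed intro!: poly_sum_closed)

lemma d_component:
  assumes "v \<in> component (F (Suc i)) \<gamma>"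
  shows "d i v \<in> component (F i) \<gamma>"
proof -
  have "m + label a Q = \<gamma>" if Q: "Q \<in> cls i" and m: "m \<in> Poly_Mapping.keys (d i v Q)" for m Q
  proof -
    have "(\<Sum>P \<in> cls (Suc i). Poly_Mapping.lookup (v P * coef Q P) m) \<noteq> 0"
      using m Q by (simp add: in_keys_iff d_apply lookup_sum)
    then obtain P where P: "P \<in> cls (Suc i)" "Poly_Mapping.lookup (v P * coef Q P) m \<noteq> 0"
      using sum.not_neutral_contains_not_neutral by blast
    then have "m \<in> Poly_Mapping.keys (v P * coef Q P)" by (simp add: in_keys_iff)
    then obtain m' where m': "m' \<in> Poly_Mapping.keys (v P)" "m = m' + (label a P - label a Q)"
      using keys_mult_of_int[of "v P"] unfolding coef_def by blast
    have "incidence Q P \<noteq> 0" using P(2) by (auto simp: coef_def)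
    then have "label a P - label a Q + label a Q = label a P"
      using label_mono[OF P(1)] by (simp add: expo_dvd_diff_add)
    with m' show ?thesis
      using assms P(1) by (simp add: free_module_component add.assoc)
  qed
  then show ?thesis
    using assms d_closed[of v i] by (simp add: free_module_component)
qed

section \<open>The composite of two differentials is zero\<close>

lemma rect_corners:
  assumes "good (x, y) (x, y - 1)" "good (x, y) (t, y)" "t < x"
  shows "(x, y) \<in> D" "(x, y - 1) \<in> D" "(t, y) \<in> D" "(t, y - 1) \<in> D" "2 \<le> y"
    "good (t, y) (t, y - 1)"
proof -
  show 1: "(x, y) \<in> D" "(x, y - 1) \<in> D" "(t, y) \<in> D" using assms good_D by auto
  have "1 \<le> x" "x \<le> y - 1" using D_bounds[OF 1(2)] by auto
  then show "2 \<le> y" by simp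
  \<comment> \<open>Monotonicity of \<open>mu\<close> gives mu t \<le> mu x < y - 1, while y \<le>
    lam t.\<close>
  show 2: "(t, y - 1) \<in> D"
    using 1 mu_mono[of t x] assms(3) by (auto simp: mem_D)
  show "good (t, y) (t, y - 1)" using 1 2 by (intro good_west)
qed

text \<open>Bottom, right and top edges together contribute the top left vertex minus the bottom
  left one; the left side, passing through all intermediate points of its column, telescopes to the
  opposite.\<close>

lemma incidence_sum_rect:
  assumes "good (x, y) (x, y - 1)" "good (x, y) (t, y)" "t < x"
  shows "(\<Sum>E \<in> cls (Suc (Suc 0)). incidence E (Rect x y t) * incidence (Vertex q) E) = 0"
proof -
  note rc = rect_corners[OF assms]
  define g :: "point \<Rightarrow> int" where "g c = (if q = c then 1 else 0)" for c
  define w where "w = (\<lambda>(c, c'). incidence (Edge c c') (Rect x y t) * (g c' - g c))"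
  define S where "S = {r \<in> {t..x}. (r, y - 1) \<in> D}"
  \<comment> \<open>Consecutive rows of column \<open>y - 1\<close> between \<open>t\<close> and
    \<open>x\<close>; \<open>L\<close> contains the vertical good moves joining them, oriented from
    the larger row to the smaller.\<close>
  define K where "K = {(s, r). s \<in> S \<and> r \<in> S \<and> s < r \<and> (\<forall>l. s < l \<and> l < r \<longrightarrow> l \<notin> S)}"
  define L where "L = (\<lambda>(s, r). ((r, y - 1), (s, y - 1))) ` K"
  let ?B = "((x, y), (x, y - 1))" and ?R = "((x, y), (t, y))" and ?T = "((t, y), (t, y - 1))"
  have fK: "finite K" by (rule finite_subset[of _ "S \<times> S"]) (auto simp: K_def S_def)
  have "(\<Sum>E \<in> cls (Suc (Suc 0)). incidence E (Rect x y t) * incidence (Vertex q) E)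
      = (\<Sum>(c, c') \<in> {(c, c'). good c c'}. incidence (Edge c c') (Rect x y t) * incidence (Vertex q) (Edge c c'))"
    unfolding cells_2 by (subst sum.reindex) (auto simp: inj_on_def intro!: sum.cong)
  also have "\<dots> = sum w {(c, c'). good c c'}"
    by (rule sum.cong) (auto simp: w_def g_def good_irrefl)
  also have "\<dots> = sum w ({?B, ?R, ?T} \<union> L)"
  proof (rule sum.mono_neutral_right[OF finite_good])
    show "{?B, ?R, ?T} \<union> L \<subseteq> {(c, c'). good c c'}"
      using assms rc by (auto simp: L_def K_def S_def good_move_iff)
    show "\<forall>e \<in> {(c, c'). good c c'} - ({?B, ?R, ?T} \<union> L). w e = 0"
    proof
      fix e assume e: "e \<in> {(c, c'). good c c'} - ({?B, ?R, ?T} \<union> L)"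
      obtain i j p l where eq: "e = ((i, j), (p, l))" by (metis surj_pair)
      have "\<not> (j = y - 1 \<and> l = y - 1 \<and> t \<le> p \<and> p < i \<and> i \<le> x)"
      proof
        assume *: "j = y - 1 \<and> l = y - 1 \<and> t \<le> p \<and> p < i \<and> i \<le> x"
        then have "(p, i) \<in> K" using e by (auto simp: eq K_def S_def good_move_iff)
        then have "e \<in> L" using * by (auto simp: L_def eq intro!: image_eqI[of _ _ "(p, i)"])
        with e show False by simp
      qed
      then show "w e = 0" using e by (auto simp: eq w_def)
    qed
  qed
  also have "\<dots> = sum w {?B, ?R, ?T} + sum w L"
    using fK rc(5) by (intro sum.union_disjoint) (auto simp: L_def)
  also have "sum w {?B, ?R, ?T} = g (t, y - 1) - g (x, y - 1)"
    using rc(5) assms(3) by (auto simp: w_def)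
  also have "sum w L = (\<Sum>(s, r) \<in> K. g (r, y - 1) - g (s, y - 1))"
  proof -
    have "sum w L = (\<Sum>(s, r) \<in> K. w ((r, y - 1), (s, y - 1)))"
      unfolding L_def by (subst sum.reindex) (auto simp: inj_on_def intro!: sum.cong)
    also have "\<dots> = (\<Sum>(s, r) \<in> K. g (r, y - 1) - g (s, y - 1))"
      using rc(5) by (intro sum.cong) (auto simp: K_def S_def w_def)
    finally show ?thesis .
  qed
  also have "\<dots> = - (\<Sum>(s, r) \<in> K. g (s, y - 1) - g (r, y - 1))"
    by (simp add: sum_negf[symmetric] case_prod_beta)
  also have "(\<Sum>(s, r) \<in> K. g (s, y - 1) - g (r, y - 1)) = g (Min S, y - 1) - g (Max S, y - 1)"
    unfolding K_def using rc assms(3) by (intro sum_consecutive_telescope) (auto simp: S_def)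
  also have "Min S = t" using rc assms(3) by (intro Min_eqI) (auto simp: S_def)
  also have "Max S = x" using rc assms(3) by (intro Max_eqI) (auto simp: S_def)
  finally show ?thesis by simp
qed

lemma incidence_sum_edge:
  assumes "good c c'"
  shows "(\<Sum>V \<in> cls (Suc 0). incidence V (Edge c c') * incidence EmptyFace V) = 0"
proof -
  have ne: "c \<noteq> c'" using good_before[OF assms] before_irrefl by blast
  have "(\<Sum>V \<in> cls (Suc 0). incidence V (Edge c c') * incidence EmptyFace V)
      = (\<Sum>q \<in> D. (if q = c' then 1 else 0) - (if q = c then 1 else 0))"
    unfolding cells_1 using ne by (subst sum.reindex) (auto simp: inj_on_def intro!: sum.cong)
  also have "\<dots> = 0"
    using good_D[OF assms] finite_D by (simp add: sum_subtractf)
  finally show ?thesis .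
qed

lemma incidence_sum_zero:
  assumes "P \<in> cls (Suc (Suc i))" "Q \<in> cls i"
  shows "(\<Sum>E \<in> cls (Suc i). incidence E P * incidence Q E) = 0"
proof (cases i rule: cells_4_cases)
  case 1
  then show ?thesis using assms incidence_sum_edge by (auto simp: cells_0 cells_2)
next
  case 2
  then show ?thesis using assms incidence_sum_rect by (auto simp: cells_1 cells_3)
qed (use assms in \<open>auto simp: cells_ge_4\<close>)

text \<open>The monomial picked up from \<open>P\<close> through \<open>E\<close> to
  \<open>Q\<close> is the quotient of the labels of \<open>P\<close> and \<open>Q\<close> for every
  \<open>E\<close>. It factors out and leaves the integer identity of the oriented cells.\<close>

lemma coef_sum_zero:
  assumes "P \<in> cls (Suc (Suc i))" "Q \<in> cls i"
  shows "(\<Sum>E \<in> cls (Suc i). coef E P * coef Q E) = (0 :: 'k::field mpoly)"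
proof -
  have "coef E P * coef Q E
      = of_int (incidence E P * incidence Q E) * (monomial (label a P - label a Q) :: 'k mpoly)"
    if "E \<in> cls (Suc i)" for E
  proof (cases "incidence E P = 0 \<or> incidence Q E = 0")
    case False
    then have "expo_dvd (label a E) (label a P)" "expo_dvd (label a Q) (label a E)"
      using label_mono assms that by auto
    then have "label a P - label a E + (label a E - label a Q) = label a P - label a Q"
      by (intro poly_mapping_eqI) (simp add: expo_dvd_def lookup_expo)
    then show ?thesis
      by (simp add: coef_def monomial_mult algebra_simps)
  qed (auto simp: coef_def)
  then have "(\<Sum>E \<in> cls (Suc i). coef E P * coef Q E)
      = of_int (\<Sum>E \<in> cls (Suc i). incidence E P * incidence Q E)
        * (monomial (label a P - label a Q) :: 'k mpoly)"
    by (simp add: sum_distrib_right)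
  then show ?thesis by (simp add: incidence_sum_zero[OF assms])
qed

lemma d_d: "d i (d (Suc i) v) = (\<lambda>Q. 0)"
proof
  fix Q
  show "d i (d (Suc i) v) Q = 0"
  proof (cases "Q \<in> cls i")
    case True
    then have "d i (d (Suc i) v) Q
        = (\<Sum>E \<in> cls (Suc i). \<Sum>P \<in> cls (Suc (Suc i)). v P * (coef E P * coef Q E))"
      by (simp add: d_apply sum_distrib_right mult.assoc)
    also have "\<dots> = (\<Sum>P \<in> cls (Suc (Suc i)). v P * (\<Sum>E \<in> cls (Suc i). coef E P * coef Q E))"
      by (subst sum.swap) (simp add: sum_distrib_left)
    also have "\<dots> = 0" by (simp add: coef_sum_zero True)
    finally show ?thesis .
  qed (simp add: d_apply)
qed


section \<open>Exactness\<close>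

text \<open>For \<open>r = 0\<close> the face \<open>P\<close> need not be a cell. Both potential
  edges at a point can then be treated at once, even if one of the moves does not exist.\<close>

lemma coordinate_closed:
  "r \<in> carrier (poly_ring n) \<Longrightarrow> (P \<in> cls i \<or> r = 0) \<Longrightarrow> coordinate P r \<in> carrier (F i)"
  by (auto simp: free_module_carrier coordinate_def)

lemma d_coordinate:
  assumes "P \<in> cls (Suc i) \<or> r = 0"
  shows "d i (coordinate P r) Q = (if Q \<in> cls i then r * coef Q P else 0)"
proof -
  have "(\<Sum>P' \<in> cls (Suc i). coordinate P r P' * coef Q P')
      = (\<Sum>P' \<in> cls (Suc i). if P' = P then r * coef Q P' else 0)"
    by (rule sum.cong) (auto simp: coordinate_def)
  then show ?thesis using assms finite_cells by (auto simp: d_apply)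
qed

lemma free_module_add_closed:
  "v \<in> carrier (F i) \<Longrightarrow> w \<in> carrier (F i) \<Longrightarrow> (\<lambda>b. v b + w b) \<in> carrier (F i)"
  by (simp add: free_module_carrier)

lemma free_module_diff_closed:
  "v \<in> carrier (F i) \<Longrightarrow> w \<in> carrier (F i) \<Longrightarrow> (\<lambda>b. v b - w b) \<in> carrier (F i)"
  by (simp add: free_module_carrier)

lemma free_module_zero_closed: "(\<lambda>b. 0) \<in> carrier (F i)"
  by (simp add: free_module_carrier)

text \<open>Cycles are reduced to zero by eliminating their coefficients on the cells with the last corner;
  \<open>x * (n + 1) + y\<close> is a rank function for the lexicographic order on \<open>D\<close>.\<close>

lemma cycle_elimination:
  fixes v :: "face \<Rightarrow> 'k::field mpoly"
  assumes step: "\<And>c (v :: face \<Rightarrow> 'k mpoly). c \<in> D \<Longrightarrow> v \<in> carrier (F (Suc i)) \<Longrightarrow> d i v = (\<lambda>Q. 0) \<Longrightarrow>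
      (\<And>P. P \<in> cls (Suc i) \<Longrightarrow> before c (corner P) \<Longrightarrow> v P = 0) \<Longrightarrow>
      \<exists>u \<in> carrier (F (Suc (Suc i))). \<forall>P \<in> cls (Suc i).
        (corner P = c \<longrightarrow> d (Suc i) u P = v P) \<and> (before c (corner P) \<longrightarrow> d (Suc i) u P = 0)"
    and v: "v \<in> carrier (F (Suc i))" "d i v = (\<lambda>Q. 0)"
  shows "\<exists>u \<in> carrier (F (Suc (Suc i))). v = d (Suc i) u"
proof -
  define rk where "rk c = fst c * Suc n + snd c" for c :: point
  have rk: "rk c < rk c' \<longleftrightarrow> before c c'" if "c \<in> D" "c' \<in> D" for c c'
  proof -
    have less: "rk c < rk c'" if "before c c'" "c \<in> D" "c' \<in> D" for c c'
    proof (cases "fst c < fst c'")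
      case True
      then have "Suc (fst c) * Suc n \<le> fst c' * Suc n" by (intro mult_le_mono1) simp
      moreover have "snd c \<le> n" using D_bounds[of "fst c" "snd c"] that by simp
      ultimately show ?thesis by (simp add: rk_def)
    qed (use that in \<open>auto simp: before_def rk_def\<close>)
    show ?thesis using less[of c c'] less[of c' c] that before_total[of c c'] by fastforce
  qed
  have main: "\<exists>u \<in> carrier (F (Suc (Suc i))). v = d (Suc i) u"
    if "v \<in> carrier (F (Suc i))" "d i v = (\<lambda>Q. 0)" "\<forall>P \<in> cls (Suc i). N \<le> rk (corner P) \<longrightarrow> v P = 0"
    for N and v :: "face \<Rightarrow> 'k mpoly"
    using that
  proof (induction N arbitrary: v)
    case 0
    then have "v = (\<lambda>P. 0)" by (auto simp: free_module_carrier)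
    then have "v = d (Suc i) (\<lambda>P. 0)" by (simp add: cellular_map_zero fun_eq_iff)
    then show ?case using free_module_zero_closed by blast
  next
    case (Suc N)
    have "\<exists>u \<in> carrier (F (Suc (Suc i))). \<forall>P \<in> cls (Suc i). N \<le> rk (corner P) \<longrightarrow> d (Suc i) u P = v P"
    \<comment> \<open>If \<open>N\<close> is the rank of no point, the coefficients already vanish
      from \<open>N\<close> on, and the zero chain serves.\<close>
    proof (cases "\<exists>c \<in> D. rk c = N")
      case True
      then obtain c where c: "c \<in> D" "rk c = N" by blast
      have later: "v P = 0" if "P \<in> cls (Suc i)" "before c (corner P)" for P
        using Suc.prems(3) that rk[OF c(1) corner_in_D[OF that(1)]] c(2) by simp
      from step[OF c(1) Suc.prems(1,2) later] obtain u where u: "u \<in> carrier (F (Suc (Suc i)))"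
        "\<And>P. P \<in> cls (Suc i) \<Longrightarrow> corner P = c \<Longrightarrow> d (Suc i) u P = v P"
        "\<And>P. P \<in> cls (Suc i) \<Longrightarrow> before c (corner P) \<Longrightarrow> d (Suc i) u P = 0"
        by blast
      have "d (Suc i) u P = v P" if P: "P \<in> cls (Suc i)" "N \<le> rk (corner P)" for P
      proof (cases "corner P = c")
        case False
        then have "before c (corner P)"
          using P c rk[OF corner_in_D[OF P(1)] c(1)] before_total[OF False] by auto
        then show ?thesis using u(3) later P(1) by simp
      qed (use u(2) P in blast)
      then show ?thesis using u(1) by blast
    next
      case False
      then have "v P = 0" if "P \<in> cls (Suc i)" "N \<le> rk (corner P)" for P
        using that Suc.prems(3) corner_in_D[OF that(1)] by (metis le_neq_implies_less Suc_leI)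
      then show ?thesis
        using free_module_zero_closed by (intro bexI[of _ "\<lambda>b. 0"]) (auto simp: cellular_map_zero)
    qed
    then obtain u where u: "u \<in> carrier (F (Suc (Suc i)))"
      "\<forall>P \<in> cls (Suc i). N \<le> rk (corner P) \<longrightarrow> d (Suc i) u P = v P" by blast
    \<comment> \<open>Subtracting a boundary keeps a cycle, by \<open>d_d\<close>. Coefficients at
      earlier corners may change, which the induction hypothesis allows.\<close>
    define w where "w = (\<lambda>b. v b - d (Suc i) u b)"
    have "w \<in> carrier (F (Suc i))"
      unfolding w_def using Suc.prems(1) d_closed[OF u(1)] by (rule free_module_diff_closed)
    moreover have "d i w = (\<lambda>Q. 0)"
      unfolding w_def using Suc.prems(2) by (simp add: fun_eq_iff cellular_map_diff d_d)
    moreover have "\<forall>P \<in> cls (Suc i). N \<le> rk (corner P) \<longrightarrow> w P = 0"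
      using u(2) by (simp add: w_def)
    ultimately obtain u' where u': "u' \<in> carrier (F (Suc (Suc i)))" "w = d (Suc i) u'"
      using Suc.IH by blast
    have "v = d (Suc i) (\<lambda>b. u b + u' b)"
      using u'(2) by (auto simp: fun_eq_iff cellular_map_add w_def algebra_simps)
    then show ?case using free_module_add_closed[OF u(1) u'(1)] by blast
  qed
  \<comment> \<open>Rows are at most \<open>h\<close> and columns at most \<open>n\<close>, so from
    this bound on nothing is required of the given cycle.\<close>
  have "rk (corner P) < Suc h * Suc n" if "P \<in> cls (Suc i)" for P
  proof -
    have "fst (corner P) \<le> h" "snd (corner P) \<le> n"
      using D_bounds[of "fst (corner P)" "snd (corner P)"] corner_in_D[OF that] by auto
    then show ?thesis
      using mult_le_mono1[of "fst (corner P)" h "Suc n"] by (simp add: rk_def)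
  qed
  then show ?thesis using main[OF v, of "Suc h * Suc n"] by fastforce
qed

section \<open>Exactness at vertices, edges and rectangles\<close>

lemma d_0_apply: "d 0 v EmptyFace = (\<Sum>c \<in> D. v (Vertex c) * monomial (a - gen_expo c))"
proof -
  have "d 0 v EmptyFace = (\<Sum>P \<in> Vertex ` D. v P * coef EmptyFace P)"
    by (simp add: d_apply cells_0 cells_1)
  also have "\<dots> = (\<Sum>c \<in> D. v (Vertex c) * monomial (a - gen_expo c))"
    by (subst sum.reindex) (auto simp: inj_on_def coef_def)
  finally show ?thesis .
qed

text \<open>Each monomial of the last coefficient has to cancel against the term of an earlier
  point. This is a divisibility between dual generators, from which \<open>colon_monomial\<close>
  extracts a variable.\<close>

lemma cycle_0_colon:
  fixes v :: "face \<Rightarrow> 'k::field mpoly"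
  assumes c: "(x, y) \<in> D" and dv: "d 0 v = (\<lambda>Q. 0)"
    and later: "\<And>P. P \<in> cls (Suc 0) \<Longrightarrow> before (x, y) (corner P) \<Longrightarrow> v P = 0"
    and m: "m \<in> Poly_Mapping.keys (v (Vertex (x, y)))"
  shows "(x, y - 1) \<in> D \<and> expo_dvd (var_expo y) m \<or>
         (\<exists>t. good (x, y) (t, y) \<and> t < x) \<and> expo_dvd (var_expo x) m"
proof -
  let ?c = "(x, y)"
  have "(\<Sum>c \<in> D. v (Vertex c) * monomial (a - gen_expo c)) = 0"
    using dv by (simp add: fun_eq_iff flip: d_0_apply)
  then have sum0: "v (Vertex ?c) * monomial (a - gen_expo ?c)
      + (\<Sum>c \<in> D - {?c}. v (Vertex c) * monomial (a - gen_expo c)) = 0"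
    using c finite_D by (simp add: sum.remove)
  have "Poly_Mapping.lookup (v (Vertex ?c) * monomial (a - gen_expo ?c)) (m + (a - gen_expo ?c)) \<noteq> 0"
    using m by (simp add: lookup_mult_monomial in_keys_iff)
  then have "Poly_Mapping.lookup (\<Sum>c \<in> D - {?c}. v (Vertex c) * monomial (a - gen_expo c))
      (m + (a - gen_expo ?c)) \<noteq> 0"
    using arg_cong[OF sum0, of "\<lambda>p. Poly_Mapping.lookup p (m + (a - gen_expo ?c))"]
    by (auto simp: lookup_add)
  then obtain c' where c': "c' \<in> D" "c' \<noteq> ?c"
    "Poly_Mapping.lookup (v (Vertex c') * monomial (a - gen_expo c')) (m + (a - gen_expo ?c)) \<noteq> 0"
    unfolding lookup_sum using sum.not_neutral_contains_not_neutral by blast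
  then have "m + (a - gen_expo ?c) \<in> Poly_Mapping.keys (v (Vertex c') * monomial (a - gen_expo c'))"
    by (simp add: in_keys_iff)
  then obtain m' where m': "m + (a - gen_expo ?c) = m' + (a - gen_expo c')"
    using keys_mult[of "v (Vertex c')" "monomial (a - gen_expo c')"] by auto
  have "v (Vertex c') \<noteq> 0" using c'(3) by auto
  then have "\<not> before ?c c'" using later[of "Vertex c'"] c'(1) by (auto simp: cells_1)
  then have less: "before c' ?c" using before_total c'(2) by blast
  \<comment> \<open>Both generators divide \<open>a\<close>, so the equality of the complementary
    monomials amounts to \<open>m + gen_expo c' = m' + gen_expo ?c\<close>.\<close>
  have "expo_dvd (gen_expo ?c) (m + gen_expo c')"
    unfolding expo_dvd_def
  proof
    fix z
    have "Poly_Mapping.lookup (gen_expo ?c) z \<le> Poly_Mapping.lookup a z"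
      "Poly_Mapping.lookup (gen_expo c') z \<le> Poly_Mapping.lookup a z"
      using gen_dvd[OF c] gen_dvd[OF c'(1)] by (auto simp: expo_dvd_def)
    with arg_cong[OF m', of "\<lambda>m. Poly_Mapping.lookup m z"]
    show "Poly_Mapping.lookup (gen_expo ?c) z \<le> Poly_Mapping.lookup (m + gen_expo c') z"
      by (simp add: lookup_add lookup_minus)
  qed
  then show ?thesis
    using colon_monomial[OF c, of "fst c'" "snd c'" m] c'(1) less by (simp add: before_def)
qed

text \<open>The coefficient of the last vertex lies in the ideal of the variables of the moves that
  start there. An edge has incidence -1 at its start, so the coefficients \<open>- u\<close> and
  \<open>- w\<close> on these edges reproduce it; their other ends are earlier.\<close>

lemma exact_1:
  fixes v :: "face \<Rightarrow> 'k::field mpoly"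
  assumes "v \<in> carrier (F (Suc 0))" "d 0 v = (\<lambda>Q. 0)"
  shows "\<exists>u \<in> carrier (F (Suc (Suc 0))). v = d (Suc 0) u"
proof (rule cycle_elimination[OF _ assms])
  fix c :: point and v :: "face \<Rightarrow> 'k mpoly"
  assume c: "c \<in> D" and v: "v \<in> carrier (F (Suc 0))" and dv: "d 0 v = (\<lambda>Q. 0)"
    and later: "\<And>P. P \<in> cls (Suc 0) \<Longrightarrow> before c (corner P) \<Longrightarrow> v P = 0"
  obtain x y where xy: "c = (x, y)" by force
  define W where "W \<longleftrightarrow> (x, y - 1) \<in> D"
  define N where "N \<longleftrightarrow> (\<exists>t. good (x, y) (t, y) \<and> t < x)"
  \<comment> \<open>Without a northward move \<open>t\<close> is arbitrary, and the coefficient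
    \<open>w\<close> of its edge is zero.\<close>
  obtain t where t: "N \<Longrightarrow> good (x, y) (t, y) \<and> t < x" by (auto simp: N_def)
  have west: "W \<Longrightarrow> good (x, y) (x, y - 1)" using good_west c by (simp add: W_def xy)
  have closed: "v (Vertex c) \<in> carrier (poly_ring n)"
    using v c by (simp add: free_module_carrier cells_1)
  have colon: "W \<and> expo_dvd (var_expo y) m \<or> N \<and> expo_dvd (var_expo x) m"
    if "m \<in> Poly_Mapping.keys (v (Vertex c))" for m
    unfolding W_def N_def
    by (rule cycle_0_colon[OF c[unfolded xy] dv later[unfolded xy] that[unfolded xy]])
  obtain u w where uw: "u \<in> carrier (poly_ring n)" "w \<in> carrier (poly_ring n)"
    "v (Vertex c) = u * monomial (var_expo y) + w * monomial (var_expo x)"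
    "\<not> W \<Longrightarrow> u = 0" "\<not> N \<Longrightarrow> w = 0"
    using poly_split_divisible[OF closed colon] by blast
  let ?W = "Edge (x, y) (x, y - 1)" and ?N = "Edge (x, y) (t, y)"
  have cells: "?W \<in> cls (Suc (Suc 0)) \<or> - u = 0" "?N \<in> cls (Suc (Suc 0)) \<or> - w = 0"
    using uw(4,5) west t unfolding cells_2 by auto
  define U where "U = (\<lambda>b. coordinate ?W (- u) b + coordinate ?N (- w) b)"
  have U: "U \<in> carrier (F (Suc (Suc 0)))"
    unfolding U_def using cells uw by (intro free_module_add_closed coordinate_closed) auto
  have dU: "d (Suc 0) U (Vertex q) = - u * coef (Vertex q) ?W - w * coef (Vertex q) ?N" if "q \<in> D" for q
    unfolding U_def cellular_map_add d_coordinate[OF cells(1)] d_coordinate[OF cells(2)]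
    using that by (simp add: cells_1)
  have "d (Suc 0) U (Vertex c) = v (Vertex c)"
  proof -
    have "- u * coef (Vertex c) ?W = u * monomial (var_expo y)"
    proof (cases W)
      case True
      then have "(x, y - 1) \<noteq> (x, y)" using west good_irrefl by metis
      then show ?thesis using c label_west[of x y "y - 1"] by (simp add: coef_def xy)
    qed (simp add: uw)
    moreover have "- w * coef (Vertex c) ?N = w * monomial (var_expo x)"
    proof (cases N)
      case True
      then show ?thesis using c t label_north[of x y t] by (simp add: coef_def xy)
    qed (simp add: uw)
    ultimately show ?thesis unfolding dU[OF c] uw(3) by simp
  qed
  moreover have "d (Suc 0) U (Vertex q) = 0" if q: "q \<in> D" "before c q" for q
  proof -
    have "q \<noteq> c" using q(2) before_irrefl by blast
    moreover have "q \<noteq> (x, y - 1)" using q(2) by (auto simp: before_def xy)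
    ultimately have "u * coef (Vertex q) ?W = 0" by (simp add: coef_def xy)
    moreover have "w * coef (Vertex q) ?N = 0"
    proof (cases N)
      case True
      then have "q \<noteq> (t, y)" using q(2) t by (auto simp: before_def xy)
      with \<open>q \<noteq> c\<close> show ?thesis by (simp add: coef_def xy)
    qed (simp add: uw)
    ultimately show ?thesis unfolding dU[OF q(1)] by (simp only: mult_minus_left minus_zero diff_zero)
  qed
  ultimately show "\<exists>u \<in> carrier (F (Suc (Suc 0))). \<forall>P \<in> cls (Suc 0).
      (corner P = c \<longrightarrow> d (Suc 0) u P = v P) \<and> (before c (corner P) \<longrightarrow> d (Suc 0) u P = 0)"
    using U by (intro bexI[of _ U]) (auto simp: cells_1)
qed

text \<open>The cycle condition is read at the vertex \<open>c\<close> only. Edges that end there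
  start later and have been eliminated, so at most two edges remain, those that start there.\<close>

lemma exact_2:
  fixes v :: "face \<Rightarrow> 'k::field mpoly"
  assumes "v \<in> carrier (F (Suc (Suc 0)))" "d (Suc 0) v = (\<lambda>Q. 0)"
  shows "\<exists>u \<in> carrier (F (Suc (Suc (Suc 0)))). v = d (Suc (Suc 0)) u"
proof (rule cycle_elimination[OF _ assms])
  fix c :: point and v :: "face \<Rightarrow> 'k mpoly"
  assume c: "c \<in> D" and v: "v \<in> carrier (F (Suc (Suc 0)))" and dv: "d (Suc 0) v = (\<lambda>Q. 0)"
    and later: "\<And>P. P \<in> cls (Suc (Suc 0)) \<Longrightarrow> before c (corner P) \<Longrightarrow> v P = 0"
  obtain x y where xy: "c = (x, y)" by force
  define S where "S = {E \<in> cls (Suc (Suc 0)). corner E = c}"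
  have "(\<Sum>E \<in> cls (Suc (Suc 0)). v E * coef (Vertex c) E) = 0"
    using fun_cong[OF dv, of "Vertex c"] c by (simp add: d_apply cells_1)
  also have "(\<Sum>E \<in> cls (Suc (Suc 0)). v E * coef (Vertex c) E) = (\<Sum>E \<in> S. v E * coef (Vertex c) E)"
  proof (rule sum.mono_neutral_right[OF finite_cells])
    show "\<forall>E \<in> cls (Suc (Suc 0)) - S. v E * coef (Vertex c) E = 0"
    proof
      fix E assume E: "E \<in> cls (Suc (Suc 0)) - S"
      then obtain p q where pq: "E = Edge p q" "good p q" by (auto simp: cells_2)
      show "v E * coef (Vertex c) E = 0"
      proof (cases "c = q")
        case True
        then have "v E = 0" using later[of E] E pq good_before by auto
        then show ?thesis by simp
      next
        case False
        then show ?thesis using E pq by (auto simp: coef_def S_def)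
      qed
    qed
  qed (auto simp: S_def)
  finally have sum0: "(\<Sum>E \<in> S. v E * coef (Vertex c) E) = 0" .
  have coefW: "coef (Vertex c) (Edge c (x, y - 1)) = - (monomial (var_expo y) :: 'k mpoly)"
    if "good c (x, y - 1)"
  proof -
    have "(x, y - 1) \<noteq> c" using that good_irrefl by metis
    then show ?thesis using c label_west[of x y "y - 1"] by (simp add: coef_def xy)
  qed
  have coefN: "coef (Vertex c) (Edge c (t, y)) = - (monomial (var_expo x) :: 'k mpoly)" if "t < x" for t
    using c that label_north[of x y t] by (simp add: coef_def xy)
  show "\<exists>u \<in> carrier (F (Suc (Suc (Suc 0)))). \<forall>P \<in> cls (Suc (Suc 0)).
      (corner P = c \<longrightarrow> d (Suc (Suc 0)) u P = v P) \<and> (before c (corner P) \<longrightarrow> d (Suc (Suc 0)) u P = 0)"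
  proof (cases "good c (x, y - 1) \<and> (\<exists>t. good c (t, y) \<and> t < x)")
    case True
    then obtain t where t: "good (x, y) (x, y - 1)" "good (x, y) (t, y)" "t < x" by (auto simp: xy)
    note rc = rect_corners[OF t]
    let ?W = "Edge (x, y) (x, y - 1)" and ?N = "Edge (x, y) (t, y)" and ?R = "Rect x y t"
    have S: "S = {?W, ?N}"
    proof -
      have "E = ?W \<or> E = ?N" if E: "E \<in> S" for E
      proof -
        from E obtain c' where c': "E = Edge (x, y) c'" "good (x, y) c'"
          by (auto simp: S_def cells_2 xy)
        from c'(2) show ?thesis
        proof (cases rule: edge_cases)
          case (2 t')
          then have "t' = t" using good_north_unique c'(2) t(2) by metis
          then show ?thesis using c' 2 by simp
        qed (simp add: c')
      qed
      moreover have "?W \<in> S" "?N \<in> S" using t by (auto simp: S_def cells_2 xy)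
      ultimately show ?thesis by blast
    qed
    have "v ?W * monomial (var_expo y) + v ?N * monomial (var_expo x) = 0"
      using sum0 coefW coefN[OF t(3)] t unfolding S xy by (simp add: neg_eq_iff_add_eq_0)
    moreover have "v ?W \<in> carrier (poly_ring n)" "v ?N \<in> carrier (poly_ring n)"
      using v S by (auto simp: free_module_carrier S_def)
    \<comment> \<open>As \<open>(x, y - 1)\<close> is a point, x \<le> y - 1: the two edges carry
      distinct variables, and the relation is a Koszul syzygy.\<close>
    moreover have "x \<noteq> y" using D_bounds[OF rc(2)] rc(5) by auto
    ultimately obtain r where r: "r \<in> carrier (poly_ring n)"
      "v ?W = - (r * monomial (var_expo x))" "v ?N = r * monomial (var_expo y)"
      using variable_syzygy by metis
    have R: "?R \<in> cls (Suc (Suc (Suc 0))) \<or> r = 0" using t by (auto simp: cells_3)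
    have dU: "d (Suc (Suc 0)) (coordinate ?R r) E = r * coef E ?R" if "E \<in> cls (Suc (Suc 0))" for E
      using that by (simp add: d_coordinate[OF R])
    have coef_W: "coef ?W ?R = - (monomial (var_expo x) :: 'k mpoly)"
      using c rc(5) t(3) label_rect_bottom[of x y t "y - 1"] by (simp add: coef_def xy)
    have coef_N: "coef ?N ?R = (monomial (var_expo y) :: 'k mpoly)"
      using c rc(5) t(3) label_rect_right[of x y t] by (simp add: coef_def xy)
    have "d (Suc (Suc 0)) (coordinate ?R r) E = v E" if "E \<in> S" for E
    proof -
      have "d (Suc (Suc 0)) (coordinate ?R r) E = r * coef E ?R"
        using that by (intro dU) (simp add: S_def)
      moreover have "E = ?W \<or> E = ?N" using that unfolding S by blast
      ultimately show ?thesis using r coef_W coef_N by auto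
    qed
    \<comment> \<open>The top edge starts in row \<open>t < x\<close>, the left edges in column
      \<open>y - 1\<close> and in rows at most \<open>x\<close>; all of them start before
      \<open>c\<close>.\<close>
    moreover have "d (Suc (Suc 0)) (coordinate ?R r) E = 0"
      if E: "E \<in> cls (Suc (Suc 0))" "before c (corner E)" for E
    proof -
      obtain p q where pq: "E = Edge p q" using E by (auto simp: cells_2)
      have "incidence E ?R = 0"
        using E(2) t(3) rc(5) by (cases p; cases q) (auto simp: pq xy before_def)
      then show ?thesis using dU[OF E(1)] by (simp add: coef_def)
    qed
    ultimately show ?thesis
      using coordinate_closed[OF r(1) R] by (intro bexI[of _ "coordinate ?R r"]) (auto simp: S_def)
  next
    case False
    \<comment> \<open>A lone edge meets \<open>c\<close> with a nonzero monomial coefficient, so its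
      coordinate in the cycle is zero.\<close>
    have single: "S = {E}" if E: "E \<in> S" for E
    proof -
      have "E' = E" if E': "E' \<in> S" for E'
      proof -
        obtain p q where pq: "E = Edge (x, y) p" "good (x, y) p" "E' = Edge (x, y) q" "good (x, y) q"
          using E E' by (auto simp: S_def cells_2 xy)
        have "p = q"
          using pq(2)
        proof (cases rule: edge_cases)
          case p: 1
          show ?thesis
            using pq(4)
          proof (cases rule: edge_cases)
            case (2 t)
            then show ?thesis using False p pq by (auto simp: xy)
          qed (simp add: p)
        next
          case p: (2 t)
          show ?thesis
            using pq(4)
          proof (cases rule: edge_cases)
            case 1
            then show ?thesis using False p pq by (auto simp: xy)
          next
            case (2 t')
            then show ?thesis using good_north_unique[of x y t t'] p pq by simp
          qed
        qed
        then show ?thesis using pq by simp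
      qed
      with E show ?thesis by blast
    qed
    have "v E = 0" if E: "E \<in> S" for E
    proof -
      from E obtain c' where c': "E = Edge c c'" "good (x, y) c'" by (auto simp: S_def cells_2 xy)
      have "v E * coef (Vertex c) E = 0" using sum0 single[OF E] by simp
      moreover have "coef (Vertex c) E \<noteq> (0 :: 'k mpoly)"
        using c'(2)
      proof (cases rule: edge_cases)
        case 1
        then show ?thesis using coefW c' by (simp add: xy)
      next
        case (2 t)
        then show ?thesis using coefN[of t] c' by simp
      qed
      ultimately show ?thesis by simp
    qed
    then show ?thesis
      using free_module_zero_closed by (intro bexI[of _ "\<lambda>b. 0"]) (auto simp: cellular_map_zero S_def)
  qed
qed

text \<open>The right edge of the rectangle is the pivot. Any other rectangle can contain it only in
  its left side; the corner then lies one column further east and no higher up, hence is later and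
  already eliminated.\<close>

lemma exact_3:
  fixes v :: "face \<Rightarrow> 'k::field mpoly"
  assumes "v \<in> carrier (F (Suc (Suc (Suc 0))))" "d (Suc (Suc 0)) v = (\<lambda>Q. 0)"
  shows "\<exists>u \<in> carrier (F (Suc (Suc (Suc (Suc 0))))). v = d (Suc (Suc (Suc 0))) u"
proof (rule cycle_elimination[OF _ assms])
  fix c :: point and v :: "face \<Rightarrow> 'k mpoly"
  assume c: "c \<in> D" and dv: "d (Suc (Suc 0)) v = (\<lambda>Q. 0)"
    and later: "\<And>P. P \<in> cls (Suc (Suc (Suc 0))) \<Longrightarrow> before c (corner P) \<Longrightarrow> v P = 0"
  have "v P = 0" if P: "P \<in> cls (Suc (Suc (Suc 0)))" "corner P = c" for P
  proof -
    obtain x y t where xyt: "P = Rect x y t" "good (x, y) (x, y - 1)" "good (x, y) (t, y)" "t < x"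
      using P(1) by (auto simp: cells_3)
    note rc = rect_corners[OF xyt(2-4)]
    let ?N = "Edge (x, y) (t, y)"
    have "?N \<in> cls (Suc (Suc 0))" using xyt by (auto simp: cells_2)
    then have "(\<Sum>P' \<in> cls (Suc (Suc (Suc 0))). v P' * coef ?N P') = 0"
      using fun_cong[OF dv, of ?N] by (simp add: d_apply)
    also have "(\<Sum>P' \<in> cls (Suc (Suc (Suc 0))). v P' * coef ?N P') = (\<Sum>P' \<in> {P}. v P' * coef ?N P')"
    proof (rule sum.mono_neutral_right[OF finite_cells])
      show "\<forall>P' \<in> cls (Suc (Suc (Suc 0))) - {P}. v P' * coef ?N P' = 0"
      proof
        fix P' assume P': "P' \<in> cls (Suc (Suc (Suc 0))) - {P}"
        then obtain i j l where ijl: "P' = Rect i j l" by (auto simp: cells_3)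
        show "v P' * coef ?N P' = 0"
        proof (cases "before c (corner P')")
          case True
          then show ?thesis using later P' by simp
        next
          case False
          then have "incidence ?N P' = 0"
            using P' P(2) xyt(4) rc(5) by (auto simp: ijl xyt(1) before_def)
          then show ?thesis by (simp add: coef_def)
        qed
      qed
    qed (use P in simp)
    finally have "v P * coef ?N P = 0" by simp
    moreover have "coef ?N P = (monomial (var_expo y) :: 'k mpoly)"
      using rc xyt label_rect_right[of x y t] by (simp add: coef_def)
    ultimately show ?thesis by simp
  qed
  then show "\<exists>u \<in> carrier (F (Suc (Suc (Suc (Suc 0))))). \<forall>P \<in> cls (Suc (Suc (Suc 0))).
      (corner P = c \<longrightarrow> d (Suc (Suc (Suc 0))) u P = v P) \<and>
      (before c (corner P) \<longrightarrow> d (Suc (Suc (Suc 0))) u P = 0)"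
    using free_module_zero_closed by (intro bexI[of _ "\<lambda>b. 0"]) (auto simp: cellular_map_zero)
qed

lemma exact:
  fixes v :: "face \<Rightarrow> 'k::field mpoly"
  assumes "v \<in> carrier (F (Suc i))" "d i v = (\<lambda>Q. 0)"
  shows "\<exists>u \<in> carrier (F (Suc (Suc i))). v = d (Suc i) u"
proof -
  consider "i = 0" | "i = Suc 0" | "i = Suc (Suc 0)" | i' where "i = Suc (Suc (Suc i'))"
    by (metis not0_implies_Suc)
  then show ?thesis
  proof cases
    case 4
    then have "v = d (Suc i) (\<lambda>b. 0)"
      using assms(1) by (auto simp: free_module_carrier cells_ge_4 cellular_map_zero)
    then show ?thesis using free_module_zero_closed by blast
  qed (use assms exact_1 exact_2 exact_3 in simp_all)
qed

section \<open>Minimality and assembly of the resolution\<close>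

lemma coef_irrelevant:
  assumes P: "P \<in> cls (Suc (Suc i))"
  shows "(coef Q P :: 'k::field mpoly) \<in> irrelevant_ideal n"
proof (cases "incidence Q P = 0")
  case False
  \<comment> \<open>From vertices upward, incident labels of adjacent dimensions differ by a single
    variable. Between the empty face and a vertex the quotient is a dual generator, handled through
    properness of the ideal.\<close>
  have "\<exists>z. label a P - label a Q = var_expo z"
  proof (cases P)
    case (Edge c c')
    then have good: "good c c'"
      using P by (cases i rule: cells_4_cases) (auto simp: cells_2 cells_3 cells_ge_4)
    then have line: "fst c = fst c' \<or> snd c = snd c'" by (simp add: good_move_def minimal_move_def)
    obtain q where q: "Q = Vertex q" "q = c \<or> q = c'"
      using False Edge by (cases Q) (auto split: if_splits)
    then have "expo_dvd (var_expo (fst q) + var_expo (snd q)) a"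
      using good_D[OF good] gen_dvd by (auto simp: gen_expo_def)
    from expo_diff_var[OF this] show ?thesis
      using line q Edge by (auto simp: gen_expo_def)
  next
    case (Rect x y t)
    then have R: "good (x, y) (x, y - 1)" "good (x, y) (t, y)" "t < x"
      using P by (cases i rule: cells_4_cases; force simp: cells_2 cells_3 cells_ge_4)+
    obtain c c' where Q: "Q = Edge c c'"
      using False Rect by (cases Q) auto
    note rc = rect_corners[OF R]
    have diff: "a - (a - var_expo x) = var_expo x" "a - (a - var_expo y) = var_expo y"
      "a - (a - var_expo (y - 1)) = var_expo (y - 1)" "a - (a - var_expo t) = var_expo t"
      using expo_diff_var(3,4)[of x y a] expo_diff_var(4)[of x "y - 1" a] expo_diff_var(3)[of t y a]
        gen_dvd rc(1-3) by (auto simp: gen_expo_def)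
    \<comment> \<open>The four indices belong to the bottom, right, left and top edges, in this
      order.\<close>
    have "label a Q \<in> (\<lambda>z. a - var_expo z) ` {x, y, y - 1, t}"
      using False Rect Q R(3) rc(5) by (cases c; cases c') (auto split: if_splits)
    then show ?thesis using diff by (auto simp: Rect)
  qed (use P in \<open>cases i rule: cells_4_cases; auto simp: cells_2 cells_3 cells_ge_4\<close>)+
  then have "label a P - label a Q \<noteq> 0"
    by (metis lookup_single_eq lookup_zero zero_neq_one)
  moreover have "Poly_Mapping.keys (label a P - label a Q) \<subseteq> {1..n}"
    using keys_expo_diff keys_label by blast
  ultimately show ?thesis
    unfolding coef_def
    by (intro poly_ideal_mult[OF irrelevant_ideal_ideal] monomial_in_irrelevant_ideal) auto
qed (simp add: coef_def poly_ideal_zero[OF irrelevant_ideal_ideal])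

lemma resolution:
  fixes J :: "'k::field mpoly set"
  defines "J \<equiv> genideal (poly_ring n) ((\<lambda>c. monomial (a - gen_expo c)) ` D)"
  shows "graded_free_resolution n cls (label a) d (augmentation n J) (quotient_module n J)"
    and "J \<noteq> carrier (poly_ring n) \<Longrightarrow>
      minimal_complex n cls (label a) (d :: nat \<Rightarrow> (face \<Rightarrow> 'k mpoly) \<Rightarrow> (face \<Rightarrow> 'k mpoly))"
proof -
  have gens: "monomial (a - gen_expo c) \<in> carrier (poly_ring n)" for c
    using keys_expo_diff[of a] keys_a by auto
  have J_eq: "J = {\<Sum>c\<in>D. v c * monomial (a - gen_expo c) | v. \<forall>c \<in> D. v c \<in> carrier (poly_ring n)}"
    unfolding J_def using gens by (intro genideal_eq_combinations finite_D)
  have sub: "(\<lambda>c. monomial (a - gen_expo c) :: 'k mpoly) ` D \<subseteq> carrier (poly_ring n)"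
    using gens by auto
  have idJ: "ideal J (poly_ring n)"
    unfolding J_def by (rule poly.genideal_ideal[OF sub])
  interpret J: ideal J "poly_ring n" by (rule idJ)
  have F0: "v EmptyFace \<in> carrier (poly_ring n)" if "v \<in> carrier (F 0)" for v :: "face \<Rightarrow> 'k mpoly"
    using that by (simp add: free_module_carrier cells_0)
  have coset_eq: "J +>\<^bsub>poly_ring n\<^esub> p = J \<longleftrightarrow> p \<in> J" if "p \<in> carrier (poly_ring n)" for p
    using J.rcos_const_imp_mem[OF that] poly.a_rcos_zero[OF idJ] by blast
  have carrier_quot: "carrier (quotient_module n J) = (+>\<^bsub>poly_ring n\<^esub>) J ` carrier (poly_ring n)"
    by (auto simp: quotient_module_def FactRing_def A_RCOSETS_def')
  have aug_coordinate: "augmentation n J (coordinate EmptyFace p) = J +>\<^bsub>poly_ring n\<^esub> p" for p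
    by (simp add: augmentation_def coordinate_def)
  have hom_aug: "graded_hom n (F 0) (quotient_module n J) (augmentation n J)"
    unfolding graded_hom_def
  proof (intro conjI ballI allI)
    show "augmentation n J \<in> carrier (F 0) \<rightarrow> carrier (quotient_module n J)"
      using F0 by (auto simp: carrier_quot augmentation_def)
    fix v w :: "face \<Rightarrow> 'k mpoly" assume "v \<in> carrier (F 0)" "w \<in> carrier (F 0)"
    then show "augmentation n J (v \<oplus>\<^bsub>F 0\<^esub> w)
        = augmentation n J v \<oplus>\<^bsub>quotient_module n J\<^esub> augmentation n J w"
      using J.a_rcos_sum F0 by (simp add: augmentation_def quotient_module_def FactRing_def)
  next
    fix r :: "'k mpoly" and v :: "face \<Rightarrow> 'k mpoly"
    assume "r \<in> carrier (poly_ring n)" "v \<in> carrier (F 0)"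
    then show "augmentation n J (r \<odot>\<^bsub>F 0\<^esub> v) = r \<odot>\<^bsub>quotient_module n J\<^esub> augmentation n J v"
      using J.rcoset_mult_add F0 by (simp add: augmentation_def quotient_module_def FactRing_def)
  next
    fix \<gamma> show "augmentation n J ` component (F 0) \<gamma> \<subseteq> component (quotient_module n J) \<gamma>"
      using F0 by (auto simp: free_module_component augmentation_def quotient_module_def cells_0)
  qed
  have hom_d: "graded_hom n (F (Suc i)) (F i) (d i :: (face \<Rightarrow> 'k mpoly) \<Rightarrow> (face \<Rightarrow> 'k mpoly))" for i
    unfolding graded_hom_def
    using d_closed d_component by (auto simp: cellular_map_add cellular_map_mult fun_eq_iff)
  have onto: "augmentation n J ` carrier (F 0) = carrier (quotient_module n J)"
  proof -
    have "J +>\<^bsub>poly_ring n\<^esub> p \<in> augmentation n J ` carrier (F 0)" if "p \<in> carrier (poly_ring n)" for p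
      unfolding aug_coordinate[symmetric]
      using that by (intro imageI coordinate_closed) (simp_all add: cells_0)
    then show ?thesis
      using hom_aug by (auto simp: graded_hom_def carrier_quot)
  qed
  have exact_0: "d 0 ` carrier (F (Suc 0)) = a_kernel (F 0) (quotient_module n J) (augmentation n J)"
  proof -
    have "a_kernel (F 0) (quotient_module n J) (augmentation n J) = {v \<in> carrier (F 0). v EmptyFace \<in> J}"
      using coset_eq F0
      by (auto simp: a_kernel_def' augmentation_def quotient_module_def FactRing_def)
    also have "\<dots> = d 0 ` carrier (F (Suc 0))"
    proof (intro equalityI subsetI)
      fix v :: "face \<Rightarrow> 'k mpoly" assume v: "v \<in> {v \<in> carrier (F 0). v EmptyFace \<in> J}"
      then obtain u where u: "\<forall>c \<in> D. u c \<in> carrier (poly_ring n)"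
        "v EmptyFace = (\<Sum>c\<in>D. u c * monomial (a - gen_expo c))"
        unfolding J_eq by auto
      define w where "w P = (if P \<in> cls (Suc 0) then u (corner P) else 0)" for P
      have w: "w \<in> carrier (F (Suc 0))"
        using u(1) by (auto simp: w_def free_module_carrier cells_1)
      have "d 0 w EmptyFace = v EmptyFace"
        unfolding d_0_apply u(2) by (rule sum.cong) (auto simp: w_def cells_1)
      moreover have "v Q = 0" "d 0 w Q = 0" if "Q \<noteq> EmptyFace" for Q
        using v that by (auto simp: free_module_carrier d_apply cells_0)
      ultimately have "v = d 0 w" by (metis ext)
      with w show "v \<in> d 0 ` carrier (F (Suc 0))" by blast
    next
      fix v :: "face \<Rightarrow> 'k mpoly" assume "v \<in> d 0 ` carrier (F (Suc 0))"
      then obtain w where w: "w \<in> carrier (F (Suc 0))" "v = d 0 w" by blast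
      have "\<forall>c \<in> D. w (Vertex c) \<in> carrier (poly_ring n)"
        using w(1) by (simp add: free_module_carrier cells_1)
      then have "v EmptyFace \<in> J"
        unfolding J_eq w(2) d_0_apply by (intro CollectI exI[of _ "\<lambda>c. w (Vertex c)"] conjI refl)
      then show "v \<in> {v \<in> carrier (F 0). v EmptyFace \<in> J}" using d_closed[OF w(1)] w(2) by simp
    qed
    finally show ?thesis ..
  qed
  have exact_Suc: "d (Suc i) ` carrier (F (Suc (Suc i)))
      = a_kernel (F (Suc i)) (F i) (d i :: (face \<Rightarrow> 'k mpoly) \<Rightarrow> (face \<Rightarrow> 'k mpoly))" for i
    using exact[of _ i] d_closed[of _ "Suc i"] by (fastforce simp: a_kernel_def' d_d)
  show "graded_free_resolution n cls (label a) d (augmentation n J) (quotient_module n J)"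
    unfolding graded_free_resolution_def Let_def
    using finite_cells hom_aug hom_d onto exact_0 exact_Suc by simp
  assume proper: "J \<noteq> carrier (poly_ring n)"
  \<comment> \<open>Properness enters here: a dual generator equal to 1 would put 1 into
    \<open>J\<close>.\<close>
  have "a - gen_expo c \<noteq> 0" if "c \<in> D" for c
  proof
    assume "a - gen_expo c = 0"
    then have "1 \<in> (\<lambda>c. monomial (a - gen_expo c) :: 'k mpoly) ` D" using that by force
    then have "1 \<in> J" unfolding J_def using poly.genideal_self[OF sub] by blast
    then show False using J.one_imp_carrier proper by simp
  qed
  then have gens_irrelevant: "(monomial (a - gen_expo c) :: 'k mpoly) \<in> irrelevant_ideal n" if "c \<in> D" for c
    using that order.trans[OF keys_expo_diff keys_a] by (intro monomial_in_irrelevant_ideal) auto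
  have "d i v Q \<in> irrelevant_ideal n"
    if v: "v \<in> carrier (F (Suc i))" and Q: "Q \<in> cls i" for i Q and v :: "face \<Rightarrow> 'k mpoly"
  proof (cases i)
    case 0
    then show ?thesis
      using Q v gens_irrelevant
      by (auto simp: cells_0 d_0_apply free_module_carrier cells_1
          intro!: poly_ideal_sum[OF irrelevant_ideal_ideal] poly_ideal_mult[OF irrelevant_ideal_ideal])
  next
    case (Suc i')
    then show ?thesis
      using Q v coef_irrelevant
      by (auto simp: d_apply free_module_carrier
          intro!: poly_ideal_sum[OF irrelevant_ideal_ideal] poly_ideal_mult[OF irrelevant_ideal_ideal])
  qed
  then show "minimal_complex n cls (label a) (d :: nat \<Rightarrow> (face \<Rightarrow> 'k mpoly) \<Rightarrow> (face \<Rightarrow> 'k mpoly))"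
    by (simp add: minimal_complex_def)
qed

end

text \<open>\<open>J\<close> is the whole ring precisely when the diagram is a single point
  \<open>c\<close> with \<open>a = gen_expo c\<close>. The dual generator is then 1, the
  differential has a unit entry, and the resolution of the zero module is exact without being
  minimal.\<close>

theorem theorem6p11:
  fixes n h :: nat and lam mu :: "nat \<Rightarrow> nat" and a :: expo
    and I J :: "'k::field mpoly set"
  assumes "Poly_Mapping.keys a \<subseteq> {1..n}"
    and "shifted_partition h lam mu"
    and "\<forall>i \<in> {1..h}. lam i \<le> n"
    and "connected_diagram h lam mu"
    and "I = diagram_ideal n h lam mu"
    and "determined a I"
    and "compatible h lam mu"
    and "J = dual_ideal n a I"
  shows "graded_free_resolution n (cells h lam mu) (label a) (cellular_map h lam mu a)
           (augmentation n J) (quotient_module n J)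
       \<and> (J \<noteq> carrier (poly_ring n) \<longrightarrow>
           minimal_complex n (cells h lam mu) (label a)
             (cellular_map h lam mu a :: nat \<Rightarrow> (face \<Rightarrow> 'k mpoly) \<Rightarrow> (face \<Rightarrow> 'k mpoly)))"
proof -
  interpret compatible_diagram n h lam mu
    using assms(2-4,7) by unfold_locales
  have "Poly_Mapping.keys (gen_expo c) \<subseteq> {1..n}" if "c \<in> D" for c
    using D_bounds[of "fst c" "snd c"] that by (simp add: keys_gen_expo)
  then have min_gens: "min_gens I = gen_expo ` D"
    unfolding assms(5) diagram_ideal_def by (rule min_gens_quadratic)
  interpret cellular_resolution n h lam mu a
    using assms(1,6) min_gens by unfold_locales (auto simp: determined_def)
  have "J = genideal (poly_ring n) ((\<lambda>c. monomial (a - gen_expo c)) ` D)"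
    unfolding assms(8) dual_ideal_def min_gens by (rule arg_cong[where f = "genideal _"]) auto
  then show ?thesis using resolution by blast
qed

end
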